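(* Over $\mathbb{F}_5$, in $\mathbb{F}_5^5$, there exist multispreads with parameters $(80,7)_5^{3,5}$, $(56,8)_5^{3,5}$ and $(32,9)_5^{3,5}$. More precisely, there exist multisets of subspaces of $\mathbb{F}_5^5$ consisting of, respectively, (a) $20$ two-dimensional and $157$ three-dimensional subspaces, (b) $14$ two-dimensional and $188$ three-dimensional subspaces, (c) $8$ two-dimensional and $219$ three-dimensional subspaces, such that in each case every hyperplane of $\mathbb{F}_5^5$ contains exactly $2$ of the subspaces (counted with multiplicity); these are multispreads with the parameters $(80,7)_5^{3,5}$, $(56,8)_5^{3,5}$, $(32,9)_5^{3,5}$, respectively.
   Context: All dimensions are vector-space dimensions; a hyperplane of $\mathbb{F}_q^k$ is a $(k-1)$-dimensional subspace. A $(\lambda,\mu)_q^{h,k}$-multispread is a collection (multiset) $\mathcal{S}$ of subspaces of $\mathbb{F}_q^k$ of dimension at most $h$ such that $\sum_{S\in\mathcal{S},\,v\in S}q^{h-\dim S}=\mu$ for every non-zero vector $v\in\mathbb{F}_q^k$, and $\sum_{S\in\mathcal{S}}(q^{h-\dim S}-1)=\lambda$. *)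

theory Defs
  imports
    "HOL-Analysis.Analysis"
    "Berlekamp_Zassenhaus.Finite_Field"
begin

(* The numeral type 5 cannot index the field: prime_card is a class on type constructors, and
   5 abbreviates bit1 (bit0 num1).  Hence the five-element enumeration type. *)
instance Enum.finite_5 :: prime_card
proof
  have "CARD(Enum.finite_5) = 5"
    by (simp add: UNIV_finite_5)
  then show "prime (CARD(Enum.finite_5))"
    by simp
qed

type_synonym gf5 = "Enum.finite_5 mod_ring"

lemma CARD_gf5: "CARD(gf5) = 5"
  by (simp add: UNIV_finite_5)

definition hyperplane :: "('a::field ^ 'n) set \<Rightarrow> bool" where
  "hyperplane H \<longleftrightarrow> vec.subspace H \<and> vec.dim H = CARD('n) - 1"

(* multispread h l m S: S is an (l,m)-multispread with upper parameters h and k, where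
   q = CARD('a) and k = CARD('n).  Both natural-number differences below are genuine:
   dim U is at most h, and the power of q is at least 1. *)
definition multispread ::
  "nat \<Rightarrow> nat \<Rightarrow> nat \<Rightarrow> ('a::{field,finite} ^ 'n) set multiset \<Rightarrow> bool" where
  "multispread h l m S \<longleftrightarrow>
     (\<forall>U\<in>#S. vec.subspace U \<and> vec.dim U \<le> h) \<and>
     (\<forall>v. v \<noteq> 0 \<longrightarrow>
        (\<Sum>U\<in>#filter_mset (\<lambda>U. v \<in> U) S. CARD('a) ^ (h - vec.dim U)) = m) \<and>
     (\<Sum>U\<in>#S. CARD('a) ^ (h - vec.dim U) - 1) = l"

end

(* Passing to orthogonal complements turns the hyperplane condition into a covering condition: the
   2- and 3-dimensional subspaces become 3- and 2-dimensional ones that cover every non-zero vector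
   exactly twice.  Counting the incidences between such a cover and the hyperplane orthogonal to v
   shows that the orders of the covering subspaces orthogonal to v sum up to the number of subspaces
   minus two, whatever the cover; this is the defining equation of a multispread.  So only the
   three covers have to be checked: listed projectively, the points of all their subspaces are
   each point of the projective space twice.  The covers were found by a computer search for covers
   invariant under a linear group (of order 10 for the first one and 6 for the other two). *)
theory Submission
  imports Defs
begin

section \<open>Orthogonal complements over a finite field\<close>

text \<open>Over F_5 the vector (1,2,0,0,0) is orthogonal to itself, so \<open>perp W\<close> can
  meet W and a decomposition into W and \<open>perp W\<close> fails in general. The dimension
  formula is therefore obtained by counting vectors: every new independent functional divides the
  order of its kernel by q. The numbers of subspaces come from counting points. F_5^5 has 781 points
  (one-dimensional subspaces), a 3-dimensional subspace has 31 and a 2-dimensional one has 6, so a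
  double cover by a of the former and b of the latter satisfies 31 a + 6 b = 1562. Trading 6 of the
  former for 31 of the latter keeps this balance and adds 25 subspaces, which raises \<mu> by 1 and
  lowers \<lambda> by 4 * 6 = 24; the three covers are consecutive in this sense. Testing membership
  of every vector in every subspace would be expensive. With one fixed representative for each
  point, the covering condition becomes the equality of two multisets of 1562 vectors, which is
  decided by sorting.\<close>

definition perp :: "('a::field ^ 'n) set \<Rightarrow> ('a ^ 'n) set" where
  "perp W = {x. \<forall>w\<in>W. scalar_product w x = 0}"

lemma scalar_product_add_left: "scalar_product (x + y) z = scalar_product x z + scalar_product y z"
  and scalar_product_add_right: "scalar_product z (x + y) = scalar_product z x + scalar_product z y"
  for x y z :: "'a::field ^ 'n"
  by (simp_all add: scalar_product_def algebra_simps sum.distrib)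

lemma scalar_product_scale_left: "scalar_product (c *s x) z = c * scalar_product x z"
  and scalar_product_scale_right: "scalar_product z (c *s x) = c * scalar_product z x"
  for x z :: "'a::field ^ 'n"
  by (simp_all add: scalar_product_def sum_distrib_left algebra_simps)

lemma scalar_product_zero [simp]: "scalar_product x 0 = 0" "scalar_product 0 x = 0"
  for x :: "'a::field ^ 'n"
  by (simp_all add: scalar_product_def)

lemma scalar_product_commute: "scalar_product x y = scalar_product y x"
  for x y :: "'a::field ^ 'n"
  by (simp add: scalar_product_def mult.commute)

lemma subspace_perp: "vec.subspace (perp W)"
  by (auto simp: vec.subspace_def perp_def scalar_product_add_right scalar_product_scale_right)

lemma perp_span: "perp (vec.span B) = perp B"
proof -
  have "x \<in> perp (vec.span B)" if "x \<in> perp B" for x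
  proof -
    have "vec.subspace {w. scalar_product w x = 0}"
      by (auto simp: vec.subspace_def scalar_product_add_left scalar_product_scale_left)
    moreover have "B \<subseteq> {w. scalar_product w x = 0}"
      using that by (auto simp: perp_def)
    ultimately have "vec.span B \<subseteq> {w. scalar_product w x = 0}"
      by (rule vec.span_minimal[rotated])
    then show ?thesis
      by (auto simp: perp_def)
  qed
  then show ?thesis
    by (auto simp: perp_def vec.span_base)
qed

text \<open>A basis of W stays independent when v is added, so some linear functional is 0 on W and
  1 at v; every functional on \<open>'a ^ 'n\<close> is a scalar product with a fixed
  vector.\<close>

lemma separating_vector:
  fixes v :: "'a::field ^ 'n"
  assumes "vec.subspace W" "v \<notin> W"
  obtains x where "x \<in> perp W" "scalar_product v x = 1"
proof -
  obtain B where B: "B \<subseteq> W" "vec.independent B" "W \<subseteq> vec.span B"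
    by (rule vec.basis_exists)
  then have WB: "W = vec.span B"
    using vec.span_subspace[OF B(1,3) assms(1)] by simp
  then have ind: "vec.independent (insert v B)"
    using assms(2) B by (auto simp: vec.independent_insert)
  \<comment> \<open>The functional is obtained as one coordinate of a map into
    \<open>'a ^ 'n\<close>. Since \<open>vec 1\<close> has all coordinates 1, any index serves, and
    \<open>undefined\<close> is one; the corresponding row of the matrix represents the
    functional.\<close>
  define f :: "'a ^ 'n \<Rightarrow> 'a ^ 'n" where "f x = (if x = v then vec 1 else 0)" for x
  obtain g where g: "Vector_Spaces.linear (*s) (*s) g" "\<forall>x\<in>insert v B. g x = f x"
    using vec.linear_independent_extend[OF ind, of f] by auto
  define r where "r = matrix g $ undefined"
  have r: "g x $ undefined = scalar_product x r" for x
    unfolding r_def scalar_product_def matrix_works[OF g(1), of x, symmetric]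
    by (simp add: matrix_vector_mult_def mult.commute)
  have "scalar_product v r = 1"
    using r[of v] g(2) by (simp add: f_def)
  moreover have "r \<in> perp B"
  proof -
    have "scalar_product b r = 0" if "b \<in> B" for b
    proof -
      have "b \<noteq> v"
        using that assms(2) B(1) by auto
      then show ?thesis
        using r[of b] g(2) that by (simp add: f_def)
    qed
    then show ?thesis by (simp add: perp_def)
  qed
  ultimately show ?thesis
    by (intro that) (simp_all add: WB perp_span)
qed

lemma perp_perp:
  assumes "vec.subspace W"
  shows "perp (perp W) = W"
proof
  show "W \<subseteq> perp (perp W)"
    by (auto simp: perp_def scalar_product_commute)
  show "perp (perp W) \<subseteq> W"
  proof
    fix v assume v: "v \<in> perp (perp W)"
    show "v \<in> W"
    proof (rule ccontr)
      assume "v \<notin> W"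
      then obtain x where "x \<in> perp W" "scalar_product v x = 1"
        using assms separating_vector by blast
      moreover from this v have "scalar_product x v = 0"
        by (simp add: perp_def)
      ultimately show False
        by (simp add: scalar_product_commute)
    qed
  qed
qed

text \<open>This is the duality behind the hyperplane condition: a hyperplane with normal vector y
  corresponds to the point y. The non-trivial direction is \<open>perp_perp\<close>.\<close>

lemma perp_subset_perp_singleton_iff:
  assumes "vec.subspace W"
  shows "perp W \<subseteq> perp {y} \<longleftrightarrow> y \<in> W"
proof
  assume "perp W \<subseteq> perp {y}"
  then have "scalar_product x y = 0" if "x \<in> perp W" for x
    using that by (subst scalar_product_commute) (auto simp: perp_def)
  then have "y \<in> perp (perp W)"
    by (simp add: perp_def[of "perp W"])
  then show "y \<in> W"
    by (simp add: perp_perp assms)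
qed (auto simp: perp_def)

section \<open>Orders and dimensions of spans and orthogonal complements\<close>

lemma card_kernel:
  fixes y :: "'a::{field,finite} ^ 'n"
  assumes X: "vec.subspace X" and x: "x \<in> X" "scalar_product y x \<noteq> 0"
  shows "card {z\<in>X. scalar_product y z = 0} * CARD('a) = card X"
proof -
  let ?K = "{z\<in>X. scalar_product y z = 0}"
  \<comment> \<open>X is the direct sum of the kernel and the line through x. The coefficient t of x
    in u is found by applying the functional to u, which explains the quotient in the inverse
    map.\<close>
  have "bij_betw (\<lambda>(z, t). z + t *s x) (?K \<times> UNIV) X"
  proof (rule bij_betw_byWitness[where f' = "\<lambda>u.
      let t = scalar_product y u / scalar_product y x in (u - t *s x, t)"])
    show "(\<lambda>(z, t). z + t *s x) ` (?K \<times> UNIV) \<subseteq> X"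
      using X x by (auto intro!: vec.subspace_add vec.subspace_scale)
    have "scalar_product y (u - t *s x) = scalar_product y u - t * scalar_product y x" for u t
      using scalar_product_add_right[of y "u - t *s x" "t *s x"]
      by (simp add: scalar_product_scale_right)
    then show "(\<lambda>u. let t = scalar_product y u / scalar_product y x in (u - t *s x, t)) ` X
        \<subseteq> ?K \<times> UNIV"
      using X x by (auto simp: Let_def intro!: vec.subspace_diff vec.subspace_scale)
    qed (use x in \<open>simp_all add: Let_def scalar_product_add_right scalar_product_scale_right split: prod.split\<close>)
  then have "card (?K \<times> (UNIV :: 'a set)) = card X"
    by (rule bij_betw_same_card)
  then show ?thesis
    by (simp add: card_cartesian_product)
qed

text \<open>A basis vector b outside the span of the earlier ones gives a functional that does not
  vanish on their complement (\<open>separating_vector\<close>), so adding b divides the order of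
  the complement by exactly q.\<close>

lemma card_perp_span:
  fixes B :: "('a::{field,finite} ^ 'n) set"
  assumes "vec.independent B"
  shows "card (perp (vec.span B)) * CARD('a) ^ card B = CARD('a) ^ CARD('n)"
  using finite[of B] assms
proof (induction B rule: finite_induct)
  case empty
  show ?case by (simp add: perp_def)
next
  case (insert b B)
  then have ind: "vec.independent B" and b: "b \<notin> vec.span B"
    by (auto simp: vec.independent_insert)
  obtain x where "x \<in> perp (vec.span B)" "scalar_product b x = 1"
    using separating_vector[OF vec.subspace_span b] by blast
  then have "card {z\<in>perp B. scalar_product b z = 0} * CARD('a) = card (perp B)"
    by (intro card_kernel subspace_perp) (auto simp: perp_span)
  moreover have "{z\<in>perp B. scalar_product b z = 0} = perp (insert b B)"
    by (auto simp: perp_def)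
  ultimately show ?case
    using insert.IH[OF ind] insert.hyps by (simp add: perp_span mult.assoc[symmetric])
qed

text \<open>A vector x orthogonal to the old span with product 1 with b reads off the coefficient of
  b. Inside the enlarged span its kernel is the old span, so the order grows by the factor
  q.\<close>

lemma card_span:
  fixes B :: "('a::{field,finite} ^ 'n) set"
  assumes "vec.independent B"
  shows "card (vec.span B) = CARD('a) ^ card B"
  using finite[of B] assms
proof (induction B rule: finite_induct)
  case (insert b B)
  then have ind: "vec.independent B" and b: "b \<notin> vec.span B"
    by (auto simp: vec.independent_insert)
  obtain x where x: "x \<in> perp (vec.span B)" "scalar_product b x = 1"
    using separating_vector[OF vec.subspace_span b] by blast
  have sx: "scalar_product x z = 0" if "z \<in> vec.span B" for z
    using x(1) that by (auto simp: perp_def scalar_product_commute)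
  have "{z\<in>vec.span (insert b B). scalar_product x z = 0} = vec.span B"
  proof (intro equalityI subsetI)
    fix z assume z: "z \<in> {z\<in>vec.span (insert b B). scalar_product x z = 0}"
    then obtain k where k: "z - k *s b \<in> vec.span B"
      by (auto simp: vec.span_insert)
    have "scalar_product x z = scalar_product x (z - k *s b) + k * scalar_product x b"
      by (metis diff_add_cancel scalar_product_add_right scalar_product_scale_right)
    then have "k = 0"
      using z x(2) sx[OF k] by (simp add: scalar_product_commute)
    with k show "z \<in> vec.span B" by simp
  qed (use sx vec.span_mono[of B "insert b B"] in auto)
  moreover have "card {z\<in>vec.span (insert b B). scalar_product x z = 0} * CARD('a)
      = card (vec.span (insert b B))"
    by (rule card_kernel[of _ b]) (auto simp: x(2) scalar_product_commute vec.span_base)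
  ultimately show ?case
    using insert.IH[OF ind] insert.hyps by (simp add: mult_ac)
qed simp

lemma card_subspace:
  fixes W :: "('a::{field,finite} ^ 'n) set"
  assumes "vec.subspace W"
  shows "card W = CARD('a) ^ vec.dim W"
proof -
  obtain B where "vec.independent B" "vec.span B = W" "card B = vec.dim W"
    by (metis assms vec.basis_exists vec.span_subspace)
  then show ?thesis using card_span by metis
qed

lemma card_perp:
  fixes W :: "('a::{field,finite} ^ 'n) set"
  assumes "vec.subspace W"
  shows "card (perp W) * card W = CARD('a) ^ CARD('n)"
proof -
  obtain B where "vec.independent B" "vec.span B = W"
    by (metis assms vec.basis_exists vec.span_subspace)
  then show ?thesis using card_perp_span card_span by metis
qed

lemma one_less_CARD_field: "1 < CARD('a::{field,finite})"
proof -
  have "card {0, 1 :: 'a} \<le> CARD('a)"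
    by (rule card_mono) auto
  then show ?thesis by simp
qed

lemma dim_perp:
  fixes W :: "('a::{field,finite} ^ 'n) set"
  assumes "vec.subspace W"
  shows "vec.dim (perp W) + vec.dim W = CARD('n)"
proof -
  have "CARD('a) ^ (vec.dim (perp W) + vec.dim W) = CARD('a) ^ CARD('n)"
    using card_perp[OF assms] by (simp add: card_subspace assms subspace_perp power_add)
  then show ?thesis
    using one_less_CARD_field by (metis power_inject_exp)
qed

lemma hyperplane_imp_perp:
  fixes H :: "('a::{field,finite} ^ 'n) set"
  assumes "hyperplane H"
  obtains y where "y \<noteq> 0" "H = perp {y}"
proof -
  have H: "vec.subspace H" "vec.dim H = CARD('n) - 1"
    using assms by (auto simp: hyperplane_def)
  \<comment> \<open>The case split shows the subtraction in \<open>CARD('n) - 1\<close> to be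
    genuine: the index type is non-empty.\<close>
  have "vec.dim (perp H) = 1"
    using dim_perp[OF H(1)] H(2) by (cases "CARD('n)") auto
  then obtain B where B: "B \<subseteq> perp H" "vec.independent B" "perp H \<subseteq> vec.span B" "card B = 1"
    using vec.basis_exists by metis
  then obtain y where y: "B = {y}"
    using card_1_singletonE by blast
  have "y \<noteq> 0"
    using B(2) y vec.dependent_zero by blast
  moreover have "H = perp {y}"
    by (metis B(1,3) H(1) perp_perp perp_span subspace_perp vec.span_subspace y)
  ultimately show ?thesis using that by blast
qed

section \<open>Counting incidences of a cover with a hyperplane\<close>

lemma sum_mset_card_Int:
  fixes T :: "'b set multiset"
  assumes "finite A"
  shows "(\<Sum>W\<in>#T. card (W \<inter> A)) = (\<Sum>y\<in>A. size {#W \<in># T. y \<in> W#})"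
proof (induction T)
  case (add W T)
  have "card (W \<inter> A) = (\<Sum>y\<in>A. if y \<in> W then 1 else 0)"
    using assms by (simp add: sum.If_cases Int_commute)
  moreover have "size {#V \<in># add_mset W T. y \<in> V#} = (if y \<in> W then 1 else 0) + size {#V \<in># T. y \<in> V#}" for y
    by simp
  ultimately show ?case
    using add by (simp add: sum.distrib)
qed simp

text \<open>Write s for the sum and V for the whole space. The incidences of T with V number |T| + c
  (|V| - 1), those with the hyperplane orthogonal to v number |T| + c (|V|/q - 1). A member W meets
  this hyperplane in |W| vectors if v is orthogonal to W, and in |W|/q otherwise. Taking q times the
  second count minus the first, the terms in |V| cancel and (q - 1) s = (q - 1) (|T| - c)
  remains.\<close>

lemma sum_card_subspaces_perp:
  fixes T :: "('a::{field,finite} ^ 'n) set multiset"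
  assumes sub: "\<forall>W\<in>#T. vec.subspace W"
    and cover: "\<And>y. y \<noteq> 0 \<Longrightarrow> size {#W \<in># T. y \<in> W#} = c"
    and v: "v \<noteq> 0"
  shows "(\<Sum>W\<in>#{#W \<in># T. v \<in> perp W#}. card W) + c = size T"
proof -
  let ?q = "CARD('a)"
  have zero: "{#W \<in># T. 0 \<in> W#} = T"
    using sub by (simp add: filter_mset_eq_conv vec.subspace_0)
  \<comment> \<open>The zero vector lies in all members of T, every other vector of A in c of them.
    The summand c on the left replaces a subtraction of natural numbers.\<close>
  have count: "(\<Sum>W\<in>#T. card (W \<inter> A)) + c = size T + c * card A"
    if "0 \<in> A" for A :: "('a ^ 'n) set"
  proof -
    have "(\<Sum>W\<in>#T. card (W \<inter> A)) = size T + (\<Sum>y\<in>A - {0}. size {#W \<in># T. y \<in> W#})"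
      using that by (simp add: sum_mset_card_Int sum.remove[of A 0] zero)
    also have "(\<Sum>y\<in>A - {0}. size {#W \<in># T. y \<in> W#}) = c * (card A - 1)"
      using that by (simp add: cover)
    finally show ?thesis
      using that card_gt_0_iff[of A] by (cases "card A") auto
  qed
  have "v \<notin> vec.span {}"
    using v by simp
  then obtain x where x: "scalar_product v x = 1"
    using separating_vector vec.subspace_span by metis
  have hyper: "card (perp {v}) * ?q = CARD('a ^ 'n)"
    using card_kernel[of UNIV x v] x by (simp add: perp_def)
  \<comment> \<open>Multiplying by q avoids the fraction |W|/q and allows one formula for both
    cases.\<close>
  have meet: "?q * card (W \<inter> perp {v}) = card W + (?q - 1) * (if v \<in> perp W then card W else 0)"
    if "W \<in># T" for W
  proof (cases "v \<in> perp W")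
    case True
    then have "W \<inter> perp {v} = W"
      by (auto simp: perp_def scalar_product_commute)
    then show ?thesis
      using True one_less_CARD_field[where 'a='a] by (cases "CARD('a)") auto
  next
    case False
    then obtain w where "w \<in> W" "scalar_product v w \<noteq> 0"
      by (auto simp: perp_def scalar_product_commute)
    then have "card {z\<in>W. scalar_product v z = 0} * ?q = card W"
      using sub that by (intro card_kernel) auto
    moreover have "{z\<in>W. scalar_product v z = 0} = W \<inter> perp {v}"
      by (auto simp: perp_def)
    ultimately show ?thesis
      using False by (simp add: mult.commute)
  qed
  define s where "s = (\<Sum>W\<in>#{#W \<in># T. v \<in> perp W#}. card W)"
  have s: "s = (\<Sum>W\<in>#T. if v \<in> perp W then card W else 0)"
    unfolding s_def by (induction T) auto
  have "?q * (\<Sum>W\<in>#T. card (W \<inter> perp {v}))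
      = (\<Sum>W\<in>#T. card W + (?q - 1) * (if v \<in> perp W then card W else 0))"
    unfolding sum_mset_distrib_left by (intro arg_cong[where f=sum_mset] image_mset_cong meet)
  also have "\<dots> = (\<Sum>W\<in>#T. card W) + (?q - 1) * s"
    unfolding s sum_mset.distrib sum_mset_distrib_left ..
  finally have *: "?q * (\<Sum>W\<in>#T. card (W \<inter> perp {v})) = (\<Sum>W\<in>#T. card W) + (?q - 1) * s" .
  have all: "(\<Sum>W\<in>#T. card W) + c = size T + c * CARD('a ^ 'n)"
    using count[of UNIV] by simp
  have v_meet: "(\<Sum>W\<in>#T. card (W \<inter> perp {v})) + c = size T + c * card (perp {v})"
    using count[of "perp {v}"] by (simp add: perp_def)
  \<comment> \<open>Writing q as \<open>Suc p\<close> removes the truncated subtraction q - 1 from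
    the final computation, where p > 0 is cancelled.\<close>
  define p where "p = ?q - 1"
  have p: "?q = Suc p" "?q - 1 = p" and p0: "p > 0"
    using one_less_CARD_field[where 'a='a] by (auto simp: p_def)
  have "Suc p * (size T + c * card (perp {v})) = (\<Sum>W\<in>#T. card W) + p * s + Suc p * c"
    using * unfolding p v_meet[symmetric] by (simp add: distrib_left)
  also have "\<dots> = size T + c * CARD('a ^ 'n) + p * (s + c)"
    using all by (simp only: mult_Suc distrib_left)
  finally have "p * size T = p * (s + c)"
    unfolding hyper[symmetric] p by (simp add: algebra_simps)
  then show ?thesis
    using p0 by (simp add: s_def)
qed

section \<open>Multispreads from dual covers\<close>

text \<open>Let n be the dimension of the space. The complement of W has dimension n - dim W, which
  is at most h by the first hypothesis, and its weight q^(h - n + dim W) is |W| / q^(n - h). So the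
  weights at v sum up to (|T| - c) / q^(n - h) by \<open>sum_card_subspaces_perp\<close>, which is m
  by the assumption on the size of T.\<close>

lemma multispread_perp:
  fixes T :: "('a::{field,finite} ^ 'n) set multiset"
  assumes sub: "\<forall>W\<in>#T. vec.subspace W \<and> CARD('n) \<le> h + vec.dim W"
    and h: "h \<le> CARD('n)"
    and cover: "\<And>y. y \<noteq> 0 \<Longrightarrow> size {#W \<in># T. y \<in> W#} = c"
    and size: "size T = c + m * CARD('a) ^ (CARD('n) - h)"
  shows "multispread h (\<Sum>W\<in>#T. CARD('a) ^ (h - (CARD('n) - vec.dim W)) - 1) m (image_mset perp T)"
proof -
  let ?q = "CARD('a)" and ?n = "CARD('n)"
  have dim: "vec.dim (perp W) = ?n - vec.dim W" if "W \<in># T" for W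
    using dim_perp[of W] sub that by auto
  have weight: "(\<Sum>U\<in>#filter_mset (\<lambda>U. v \<in> U) (image_mset perp T). ?q ^ (h - vec.dim U)) = m"
    if "v \<noteq> 0" for v
  proof -
    let ?Tv = "{#W \<in># T. v \<in> perp W#}"
    have "?q ^ (?n - h) * ?q ^ (h - vec.dim (perp W)) = card W" if "W \<in># ?Tv" for W
    proof -
      have "vec.dim W \<le> ?n"
        using dim_perp[of W] sub that by auto
      then have "(?n - h) + (h - vec.dim (perp W)) = vec.dim W"
        using that sub h by (auto simp: dim)
      then show ?thesis
        using that sub by (auto simp: card_subspace simp flip: power_add)
    qed
    then have "?q ^ (?n - h) * (\<Sum>W\<in>#?Tv. ?q ^ (h - vec.dim (perp W))) = (\<Sum>W\<in>#?Tv. card W)"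
      unfolding sum_mset_distrib_left by (intro arg_cong[where f=sum_mset] image_mset_cong)
    moreover have "(\<Sum>W\<in>#?Tv. card W) = m * ?q ^ (?n - h)"
      using sum_card_subspaces_perp[of T c v] sub cover size that by simp
    ultimately have "(\<Sum>W\<in>#?Tv. ?q ^ (h - vec.dim (perp W))) * ?q ^ (?n - h) = m * ?q ^ (?n - h)"
      by (simp only: mult.commute)
    then have "(\<Sum>W\<in>#?Tv. ?q ^ (h - vec.dim (perp W))) = m"
      by simp
    then show ?thesis
      by (simp add: filter_mset_image_mset image_mset.compositionality o_def)
  qed
  have "(\<Sum>W\<in>#T. ?q ^ (h - vec.dim (perp W)) - 1) = (\<Sum>W\<in>#T. ?q ^ (h - (?n - vec.dim W)) - 1)"
    by (intro arg_cong[where f=sum_mset] image_mset_cong) (simp add: dim)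
  then show ?thesis
    using weight sub dim
    by (auto simp: multispread_def subspace_perp image_mset.compositionality o_def)
qed

lemma size_perp_subset_hyperplane:
  fixes T :: "('a::{field,finite} ^ 'n) set multiset"
  assumes sub: "\<forall>W\<in>#T. vec.subspace W"
    and cover: "\<And>y. y \<noteq> 0 \<Longrightarrow> size {#W \<in># T. y \<in> W#} = c"
    and H: "hyperplane H"
  shows "size {#U \<in># image_mset perp T. U \<subseteq> H#} = c"
proof -
  obtain y where y: "y \<noteq> 0" "H = perp {y}"
    using hyperplane_imp_perp[OF H] .
  have "{#W \<in># T. perp W \<subseteq> H#} = {#W \<in># T. y \<in> W#}"
    using sub by (intro filter_mset_cong) (auto simp: y(2) perp_subset_perp_singleton_iff)
  then show ?thesis
    using cover[OF y(1)] by (simp add: filter_mset_image_mset)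
qed

section \<open>Listing the points of a subspace from a basis\<close>

primrec lincombs :: "'a list \<Rightarrow> ('a::field ^ 'n) list \<Rightarrow> ('a ^ 'n) list" where
  "lincombs cs [] = [0]"
| "lincombs cs (b # bs) = concat (map (\<lambda>w. map (\<lambda>c. c *s b + w) cs) (lincombs cs bs))"

text \<open>For a basis \<open>bs\<close>, one vector on each line through the origin in its span: the combinations
  whose first non-zero coefficient is 1.\<close>
primrec points :: "'a list \<Rightarrow> ('a::field ^ 'n) list \<Rightarrow> ('a ^ 'n) list" where
  "points cs [] = []"
| "points cs (b # bs) = map (\<lambda>w. b + w) (lincombs cs bs) @ points cs bs"

lemma set_lincombs:
  assumes "set cs = UNIV"
  shows "set (lincombs cs bs) = vec.span (set bs)"
proof (induction bs)
  case (Cons b bs)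
  have "c *s b + w \<in> vec.span (insert b (set bs))" if "w \<in> vec.span (set bs)" for c w
    using that vec.span_mono[of "set bs" "insert b (set bs)"]
    by (intro vec.span_add vec.span_scale) (auto intro: vec.span_base)
  moreover have "\<exists>w\<in>vec.span (set bs). \<exists>c. x = c *s b + w"
    if x: "x \<in> vec.span (insert b (set bs))" for x
  proof -
    obtain k where "x - k *s b \<in> vec.span (set bs)"
      using x unfolding vec.span_insert by auto
    then show ?thesis
      by (intro bexI[of _ "x - k *s b"] exI[of _ k]) auto
  qed
  ultimately show ?case
    using Cons.IH assms by (auto simp: image_iff)
qed simp

lemma zero_in_points_iff:
  assumes "set cs = UNIV"
  shows "0 \<in> set (points cs (b # bs)) \<longleftrightarrow> b \<in> vec.span (set bs) \<or> 0 \<in> set (points cs bs)"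
proof -
  have "0 \<in> (+) b ` vec.span (set bs) \<longleftrightarrow> b \<in> vec.span (set bs)"
  proof
    assume "0 \<in> (+) b ` vec.span (set bs)"
    then obtain w where "w \<in> vec.span (set bs)" "b = - w"
      by (metis add_eq_0_iff2 imageE)
    then show "b \<in> vec.span (set bs)"
      by (simp add: vec.span_neg)
  next
    assume "b \<in> vec.span (set bs)"
    then show "0 \<in> (+) b ` vec.span (set bs)"
      by (intro image_eqI[of _ _ "- b"]) (auto simp: vec.span_neg)
  qed
  then show ?thesis
    by (simp add: set_lincombs assms)
qed

text \<open>In a dependent or repetitive list some entry lies in the span of the later ones. Then
  the combination with coefficient 1 at this entry and suitable later coefficients vanishes, and it
  is listed in \<open>points\<close>.\<close>

lemma independent_if_zero_notin_points:
  assumes "set cs = UNIV" "0 \<notin> set (points cs bs)"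
  shows "vec.independent (set bs)" "distinct bs"
proof -
  have "vec.independent (set bs) \<and> distinct bs"
    using assms(2)
  proof (induction bs)
    case (Cons b bs)
    then have "b \<notin> vec.span (set bs)" "0 \<notin> set (points cs bs)"
      using zero_in_points_iff[OF assms(1)] by auto
    then show ?case
      using Cons.IH by (auto simp: vec.independent_insert vec.span_base)
  qed (simp add: vec.independent_empty)
  then show "vec.independent (set bs)" "distinct bs" by auto
qed

lemma length_lincombs: "length (lincombs cs bs) = length cs ^ length bs"
  by (induction bs) (simp_all add: length_concat o_def sum_list_triv)

text \<open>The list has q^k entries for a basis of k vectors, as many as the span that it
  enumerates.\<close>

lemma distinct_lincombs:
  fixes cs :: "'a::{field,finite} list"
  assumes cs: "set cs = UNIV" "distinct cs" and bs: "vec.independent (set bs)" "distinct bs"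
  shows "distinct (lincombs cs bs)"
proof (rule card_distinct)
  have "length cs = CARD('a)"
    using cs distinct_card by metis
  then show "card (set (lincombs cs bs)) = length (lincombs cs bs)"
    using bs by (simp add: set_lincombs cs(1) card_span length_lincombs distinct_card)
qed

lemma length_filter_eq_distinct:
  assumes "distinct xs"
  shows "length (filter (\<lambda>x. x = y) xs) = (if y \<in> set xs then 1 else 0)"
  using assms by (induction xs) auto

text \<open>Here y need not be normalised, so what is counted is the listed points on the line
  through y. If y is in the span of the tail, the new points b + w miss its line. If y is new, its
  non-zero coefficient k at b fixes the scalar, so exactly one w remains.\<close>

lemma length_filter_points:
  fixes cs :: "'a::{field,finite} list"
  assumes cs: "set cs = UNIV" "distinct cs" and z: "0 \<notin> set (points cs bs)" and y: "y \<noteq> 0"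
  shows "length (filter (\<lambda>z. y \<in> vec.span {z}) (points cs bs))
    = (if y \<in> vec.span (set bs) then 1 else 0)"
  using z
proof (induction bs)
  case Nil
  show ?case using y by simp
next
  case (Cons b bs)
  let ?S = "vec.span (set bs)"
  have b: "b \<notin> ?S" and z: "0 \<notin> set (points cs bs)"
    using Cons.prems zero_in_points_iff[OF cs(1)] by auto
  have line: "\<exists>c. c \<noteq> 0 \<and> y = c *s (b + w)" if w: "y \<in> vec.span {b + w}" for w
  proof -
    obtain c where "y = c *s (b + w)"
      using w unfolding vec.span_singleton by auto
    then show ?thesis
      using y by (intro exI[of _ c]) auto
  qed
  have scale_b: "c = 0" if "c *s b \<in> ?S" for c
    using vec.span_scale[OF that, of "1 / c"] b by (cases "c = 0") auto
  consider "y \<in> ?S" | "y \<notin> ?S" "y \<in> vec.span (insert b (set bs))"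
    | "y \<notin> vec.span (insert b (set bs))"
    by blast
  then have "length (filter (\<lambda>w. y \<in> vec.span {b + w}) (lincombs cs bs))
    = (if y \<in> vec.span (insert b (set bs)) \<and> y \<notin> ?S then 1 else 0)"
  proof cases
    case 1
    have "y \<notin> vec.span {b + w}" if w: "w \<in> ?S" for w
    proof
      assume "y \<in> vec.span {b + w}"
      then obtain c where c: "c \<noteq> 0" "y = c *s (b + w)"
        using line by blast
      then have "c *s b = y - c *s w"
        by (simp add: vec.scale_right_distrib)
      then show False
        using scale_b[of c] c(1) vec.span_diff[OF 1 vec.span_scale[OF w, of c]] by simp
    qed
    then have "filter (\<lambda>w. y \<in> vec.span {b + w}) (lincombs cs bs) = []"
      by (simp add: filter_empty_conv set_lincombs cs(1))
    with 1 show ?thesis by simp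
  next
    case 2
    then obtain k where k: "y - k *s b \<in> ?S"
      unfolding vec.span_insert by blast
    then have k0: "k \<noteq> 0"
      using 2(1) by auto
    \<comment> \<open>Dividing y by its coefficient at b gives b + u, the only listed point on the
      line of y.\<close>
    define u where "u = (1 / k) *s (y - k *s b)"
    have u: "u \<in> ?S"
      unfolding u_def by (rule vec.span_scale[OF k])
    have yu: "y = k *s (b + u)"
      using k0 by (simp add: u_def vec.scale_right_distrib)
    have "y \<in> vec.span {b + w} \<longleftrightarrow> w = u" if w: "w \<in> ?S" for w
    proof
      assume "y \<in> vec.span {b + w}"
      then obtain c where c: "c \<noteq> 0" "y = c *s (b + w)"
        using line by blast
      have "(c - k) *s b = (y - k *s b) - c *s w"
        by (simp add: c(2) vec.scale_right_distrib vec.scale_left_diff_distrib)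
      then have "c = k"
        using scale_b[of "c - k"] vec.span_diff[OF k vec.span_scale[OF w, of c]]
        by (metis eq_iff_diff_eq_0)
      then have "k *s (b + w) = k *s (b + u)"
        using c(2) yu by (simp only:)
      then have "b + w = b + u"
        by (rule vec.scale_left_imp_eq[OF k0])
      then show "w = u"
        by simp
    next
      assume "w = u"
      moreover have "k *s (b + u) \<in> vec.span {b + u}"
        by (intro vec.span_scale vec.span_base) simp
      ultimately show "y \<in> vec.span {b + w}"
        using yu by (simp only:)
    qed
    then have "filter (\<lambda>w. y \<in> vec.span {b + w}) (lincombs cs bs)
        = filter (\<lambda>w. w = u) (lincombs cs bs)"
      by (intro filter_cong) (simp_all add: set_lincombs cs(1))
    moreover have "distinct (lincombs cs bs)"
      using distinct_lincombs[OF cs] independent_if_zero_notin_points[OF cs(1) z] by blast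
    ultimately show ?thesis
      using u 2 by (simp add: length_filter_eq_distinct set_lincombs cs(1))
  next
    case 3
    have "y \<notin> vec.span {b + w}" if "w \<in> ?S" for w
    proof -
      have "b + w \<in> vec.span (insert b (set bs))"
        using that vec.span_mono[of "set bs" "insert b (set bs)"]
        by (intro vec.span_add) (auto intro: vec.span_base)
      then have "{b + w} \<subseteq> vec.span (insert b (set bs))"
        by simp
      then have "vec.span {b + w} \<subseteq> vec.span (insert b (set bs))"
        by (rule vec.span_minimal[OF _ vec.subspace_span])
      with 3 show ?thesis by blast
    qed
    then have "filter (\<lambda>w. y \<in> vec.span {b + w}) (lincombs cs bs) = []"
      by (simp add: filter_empty_conv set_lincombs cs(1))
    with 3 show ?thesis by simp
  qed
  moreover have "?S \<subseteq> vec.span (insert b (set bs))"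
    by (rule vec.span_mono) auto
  then have "y \<in> ?S \<Longrightarrow> y \<in> vec.span (insert b (set bs))"
    by (rule subsetD)
  ultimately show ?case
    using Cons.IH[OF z] by (simp add: filter_map o_def)
qed

text \<open>The representatives in \<open>points cs es\<close> are non-zero, so by the hypothesis on the multisets no
  combination of a list in \<open>Bs\<close> vanishes: its independence need not be assumed.\<close>
lemma projective_cover:
  fixes cs :: "'a::{field,finite} list" and Bs :: "('a ^ 'n) list list"
  assumes cs: "set cs = UNIV" "distinct cs"
    and es: "vec.span (set es) = UNIV" "0 \<notin> set (points cs es)"
    and mset: "mset (concat (map (points cs) Bs)) = repeat_mset c (mset (points cs es))"
  shows projective_cover_basis: "\<forall>bs\<in>set Bs. vec.dim (vec.span (set bs)) = length bs"
    and projective_cover_size: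
      "y \<noteq> 0 \<Longrightarrow> size {#W \<in># mset (map (\<lambda>bs. vec.span (set bs)) Bs). y \<in> W#} = c"
proof -
  have "count (mset (points cs es)) 0 = 0"
    using es(2) by (simp only: count_eq_zero_iff set_mset_mset not_False_eq_True)
  then have "count (mset (concat (map (points cs) Bs))) 0 = 0"
    unfolding mset by simp
  then have "0 \<notin> set (concat (map (points cs) Bs))"
    by (simp only: count_eq_zero_iff set_mset_mset not_False_eq_True)
  then have z: "0 \<notin> set (points cs bs)" if "bs \<in> set Bs" for bs
    using that by auto
  show "\<forall>bs\<in>set Bs. vec.dim (vec.span (set bs)) = length bs"
  proof
    fix bs assume "bs \<in> set Bs"
    note * = independent_if_zero_notin_points[OF cs(1) z[OF this]]
    show "vec.dim (vec.span (set bs)) = length bs"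
      using vec.dim_eq_card_independent[OF *(1)] *(2) by (simp add: distinct_card)
  qed
  assume y: "y \<noteq> 0"
  \<comment> \<open>A subspace through y lists exactly one point on the line of y, and any other
    subspace lists none. So subspaces through y are counted by points, and the count depends only on
    the multiset of all points.\<close>
  have "size {#W \<in># mset (map (\<lambda>bs. vec.span (set bs)) Bs). y \<in> W#}
    = size {#z \<in># mset (concat (map (points cs) Bs)). y \<in> vec.span {z}#}"
    using z
  proof (induction Bs)
    case (Cons bs Bs)
    then show ?case
      using length_filter_points[OF cs, of bs y] y
      by (simp flip: mset_filter)
  qed simp
  also have "\<dots> = c * size {#z \<in># mset (points cs es). y \<in> vec.span {z}#}"
    unfolding mset by (induction c) simp_all
  also have "\<dots> = c"
    using length_filter_points[OF cs es(2) y] es(1) by (simp flip: mset_filter)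
  finally show "size {#W \<in># mset (map (\<lambda>bs. vec.span (set bs)) Bs). y \<in> W#} = c" .
qed

section \<open>Vectors over the field of five elements as data\<close>

text \<open>Free constructors let the covers be checked by rewriting alone, without the arithmetic
  of \<open>gf5\<close>. Addition and multiplication are iterations of \<open>suc5\<close>, so their
  agreement with the field operations reduces to \<open>val5_suc5\<close>.\<close>

datatype F5 = D0 | D1 | D2 | D3 | D4

fun suc5 :: "F5 \<Rightarrow> F5" where
  "suc5 D0 = D1" | "suc5 D1 = D2" | "suc5 D2 = D3" | "suc5 D3 = D4" | "suc5 D4 = D0"

fun add5 :: "F5 \<Rightarrow> F5 \<Rightarrow> F5" where
  "add5 D0 y = y"
| "add5 D1 y = suc5 y"
| "add5 D2 y = suc5 (suc5 y)"
| "add5 D3 y = suc5 (suc5 (suc5 y))"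
| "add5 D4 y = suc5 (suc5 (suc5 (suc5 y)))"

fun mult5 :: "F5 \<Rightarrow> F5 \<Rightarrow> F5" where
  "mult5 D0 y = D0"
| "mult5 D1 y = y"
| "mult5 D2 y = add5 y y"
| "mult5 D3 y = add5 y (add5 y y)"
| "mult5 D4 y = add5 y (add5 y (add5 y y))"

datatype vec5 = V F5 F5 F5 F5 F5

fun vadd :: "vec5 \<Rightarrow> vec5 \<Rightarrow> vec5" where
  "vadd (V a b c d e) (V a' b' c' d' e') = V (add5 a a') (add5 b b') (add5 c c') (add5 d d') (add5 e e')"

fun vscale :: "F5 \<Rightarrow> vec5 \<Rightarrow> vec5" where
  "vscale k (V a b c d e) = V (mult5 k a) (mult5 k b) (mult5 k c) (mult5 k d) (mult5 k e)"

text \<open>The order of enumeration is that of \<open>lincombs\<close>, so \<open>vec_of\<close>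
  maps one list to the other entry by entry.\<close>

primrec lincombs5 :: "vec5 list \<Rightarrow> vec5 list" where
  "lincombs5 [] = [V D0 D0 D0 D0 D0]"
| "lincombs5 (b # bs) =
    concat (map (\<lambda>w. map (\<lambda>c. vadd (vscale c b) w) [D0, D1, D2, D3, D4]) (lincombs5 bs))"

primrec points5 :: "vec5 list \<Rightarrow> vec5 list" where
  "points5 [] = []"
| "points5 (b # bs) = map (\<lambda>w. vadd b w) (lincombs5 bs) @ points5 bs"

definition unit5 :: "vec5 list" where
  "unit5 = [V D1 D0 D0 D0 D0, V D0 D1 D0 D0 D0, V D0 D0 D1 D0 D0, V D0 D0 D0 D1 D0, V D0 D0 D0 D0 D1]"

text \<open>One pass of a bucket sort by the first coordinate, which is rotated to the end, so that
  five passes sort a list of vectors without any comparison.\<close>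
fun pass5 :: "vec5 list \<Rightarrow> vec5 list \<Rightarrow> vec5 list \<Rightarrow> vec5 list \<Rightarrow> vec5 list \<Rightarrow> vec5 list \<Rightarrow> vec5 list"
where
  "pass5 [] as bs cs ds es = as @ bs @ cs @ ds @ es"
| "pass5 (V D0 b c d e # xs) as bs cs ds es = pass5 xs (V b c d e D0 # as) bs cs ds es"
| "pass5 (V D1 b c d e # xs) as bs cs ds es = pass5 xs as (V b c d e D1 # bs) cs ds es"
| "pass5 (V D2 b c d e # xs) as bs cs ds es = pass5 xs as bs (V b c d e D2 # cs) ds es"
| "pass5 (V D3 b c d e # xs) as bs cs ds es = pass5 xs as bs cs (V b c d e D3 # ds) es"
| "pass5 (V D4 b c d e # xs) as bs cs ds es = pass5 xs as bs cs ds (V b c d e D4 # es)"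

text \<open>Filling a bucket at its front reverses it, so a pass reverses vectors with equal keys
  instead of keeping their order. The result is still a fixed linear order: lexicographic, with the
  last coordinate most significant and with directions that alternate from one coordinate to the
  next.\<close>

definition sort5 :: "vec5 list \<Rightarrow> vec5 list" where
  "sort5 xs = (let p = (\<lambda>xs. pass5 xs [] [] [] [] []) in p (p (p (p (p xs)))))"

fun rotate5 :: "vec5 \<Rightarrow> vec5" where
  "rotate5 (V a b c d e) = V b c d e a"

lemma mset_pass5:
  "mset (pass5 xs as bs cs ds es) =
    image_mset rotate5 (mset xs) + mset as + mset bs + mset cs + mset ds + mset es"
  by (induction xs as bs cs ds es rule: pass5.induct) simp_all

text \<open>Five rotations restore every vector. Hence equal outputs of \<open>sort5\<close> imply
  equal multisets, which is the direction on which the check of the covers rests.\<close>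

lemma mset_sort5: "mset (sort5 xs) = mset xs"
proof -
  have "rotate5 (rotate5 (rotate5 (rotate5 (rotate5 x)))) = x" for x
    by (cases x) simp
  then show ?thesis
    by (simp add: sort5_def mset_pass5 image_mset.compositionality o_def)
qed

section \<open>Interpretation of the data in \<open>gf5 ^ 5\<close>\<close>

primrec val5 :: "F5 \<Rightarrow> gf5" where
  "val5 D0 = 0" | "val5 D1 = 1" | "val5 D2 = 2" | "val5 D3 = 3" | "val5 D4 = 4"

lemma CARD_finite_5: "CARD(Enum.finite_5) = 5"
  by (simp add: UNIV_finite_5)

lemma of_nat_gf5_eq_iff: "(of_nat m :: gf5) = of_nat n \<longleftrightarrow> m mod 5 = n mod 5"
  by (simp add: of_nat_eq_iff_cong_CHAR cong_def CARD_finite_5)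

lemma five_gf5: "(5 :: gf5) = 0"
  using of_nat_gf5_eq_iff[of 5 0] by simp

lemma val5_suc5: "val5 (suc5 x) = val5 x + 1"
  using five_gf5 by (cases x) simp_all

lemma val5_add5: "val5 (add5 x y) = val5 x + val5 y"
  by (cases x) (simp_all add: val5_suc5)

lemma val5_mult5: "val5 (mult5 x y) = val5 x * val5 y"
  by (cases x) (simp_all add: val5_add5)

primrec nat5 :: "F5 \<Rightarrow> nat" where
  "nat5 D0 = 0" | "nat5 D1 = 1" | "nat5 D2 = 2" | "nat5 D3 = 3" | "nat5 D4 = 4"

lemma inj_val5: "inj val5"
proof (rule injI)
  fix x y assume "val5 x = val5 y"
  moreover have "val5 z = of_nat (nat5 z)" for z
    by (cases z) simp_all
  ultimately have "nat5 x mod 5 = nat5 y mod 5"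
    by (simp add: of_nat_gf5_eq_iff)
  then show "x = y"
    by (cases x; cases y) simp_all
qed

lemma UNIV_gf5: "set [0, 1, 2, 3, 4 :: gf5] = UNIV" and distinct_gf5: "distinct [0, 1, 2, 3, 4 :: gf5]"
proof -
  have *: "[0, 1, 2, 3, 4 :: gf5] = map val5 [D0, D1, D2, D3, D4]"
    by simp
  show "distinct [0, 1, 2, 3, 4 :: gf5]"
    unfolding * by (rule distinct_map[THEN iffD2], intro conjI inj_on_subset[OF inj_val5]) simp_all
  then have "card (set [0, 1, 2, 3, 4 :: gf5]) = CARD(gf5)"
    unfolding CARD_gf5 by (simp only: distinct_card) simp
  then show "set [0, 1, 2, 3, 4 :: gf5] = UNIV"
    by (intro card_subset_eq) auto
qed

text \<open>Some enumeration of the index type; which coordinate comes first is irrelevant.\<close>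
definition coord :: "5 \<Rightarrow> nat" where
  "coord = (SOME f. bij_betw f UNIV {0..<5})"

lemma bij_betw_coord: "bij_betw coord UNIV {0..<5}"
proof -
  have "\<exists>f :: 5 \<Rightarrow> nat. bij_betw f UNIV {0..<5}"
    using ex_bij_betw_finite_nat[of "UNIV :: 5 set"] by simp
  then show ?thesis
    unfolding coord_def by (rule someI_ex)
qed

primrec vec_of :: "vec5 \<Rightarrow> gf5 ^ 5" where
  "vec_of (V a b c d e) = (\<chi> i. [val5 a, val5 b, val5 c, val5 d, val5 e] ! coord i)"

lemma coord_cases: "coord i \<in> {0, 1, 2, 3, 4}"
proof -
  have "coord i < 5"
    using bij_betw_coord by (auto simp: bij_betw_def)
  then show ?thesis by auto
qed

lemma vec_of_vadd: "vec_of (vadd x y) = vec_of x + vec_of y"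
proof -
  obtain a b c d e where x: "x = V a b c d e"
    by (cases x)
  obtain a' b' c' d' e' where y: "y = V a' b' c' d' e'"
    by (cases y)
  have "vec_of (vadd x y) $ i = vec_of x $ i + vec_of y $ i" for i
    using coord_cases[of i] by (auto simp: x y val5_add5)
  then show ?thesis
    by (simp add: vec_eq_iff)
qed

lemma vec_of_vscale: "vec_of (vscale k x) = val5 k *s vec_of x"
proof -
  obtain a b c d e where x: "x = V a b c d e"
    by (cases x)
  have "vec_of (vscale k x) $ i = val5 k * vec_of x $ i" for i
    using coord_cases[of i] by (auto simp: x val5_mult5)
  then show ?thesis
    by (simp add: vec_eq_iff)
qed

lemma inj_vec_of: "inj vec_of"
proof (rule injI)
  fix x y assume eq: "vec_of x = vec_of y"
  obtain a b c d e where x: "x = V a b c d e"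
    by (cases x)
  obtain a' b' c' d' e' where y: "y = V a' b' c' d' e'"
    by (cases y)
  have "[val5 a, val5 b, val5 c, val5 d, val5 e] ! n = [val5 a', val5 b', val5 c', val5 d', val5 e'] ! n"
    if "n < 5" for n
  proof -
    have "n \<in> range coord"
      using that bij_betw_imp_surj_on[OF bij_betw_coord] by simp
    then obtain i where i: "n = coord i"
      by (rule rangeE)
    have "vec_of x $ i = vec_of y $ i"
      using eq by (rule arg_cong)
    then show ?thesis
      by (simp add: x y i)
  qed
  from this[of 0] this[of 1] this[of 2] this[of 3] this[of 4] show "x = y"
    by (simp add: x y inj_eq[OF inj_val5])
qed

lemma vec_of_zero: "vec_of (V D0 D0 D0 D0 D0) = 0"
proof -
  have "vec_of (V D0 D0 D0 D0 D0) $ i = 0" for i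
    using coord_cases[of i] by auto
  then show ?thesis
    by (simp add: vec_eq_iff)
qed

lemma map_vec_of_lincombs5: "map vec_of (lincombs5 bs) = lincombs [0, 1, 2, 3, 4] (map vec_of bs)"
proof (induction bs)
  case Nil
  show ?case
    using vec_of_zero by simp
next
  case (Cons b bs)
  then show ?case
    by (simp add: map_concat o_def vec_of_vadd vec_of_vscale flip: Cons.IH)
qed

lemma map_vec_of_points5: "map vec_of (points5 bs) = points [0, 1, 2, 3, 4] (map vec_of bs)"
  by (induction bs) (simp_all add: o_def vec_of_vadd flip: map_vec_of_lincombs5)

text \<open>Evaluated for the standard basis only; \<open>projective_cover\<close> transfers it to
  all bases of a cover.\<close>

lemma zero_notin_points_unit5: "0 \<notin> set (points [0, 1, 2, 3, 4] (map vec_of unit5))"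
proof -
  have "list_all (\<lambda>v. v \<noteq> V D0 D0 D0 D0 D0) (points5 unit5)"
    by (simp add: unit5_def)
  then have "V D0 D0 D0 D0 D0 \<notin> set (points5 unit5)"
    unfolding list_all_iff by blast
  then have "vec_of (V D0 D0 D0 D0 D0) \<notin> vec_of ` set (points5 unit5)"
    unfolding inj_image_mem_iff[OF inj_vec_of] .
  then show ?thesis
    unfolding vec_of_zero map_vec_of_points5[symmetric] set_map .
qed

text \<open>Independence is already certified by the preceding lemma, so the span has 5^5 elements
  and is everything.\<close>

lemma span_unit5: "vec.span (set (map vec_of unit5)) = UNIV"
proof -
  note * = independent_if_zero_notin_points[OF UNIV_gf5 zero_notin_points_unit5]
  have "card (vec.span (set (map vec_of unit5))) = CARD(gf5) ^ length (map vec_of unit5)"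
    using card_span[OF *(1)] distinct_card[OF *(2)] by simp
  also have "\<dots> = CARD(gf5 ^ 5)"
    by (simp add: unit5_def CARD_finite_5)
  finally show ?thesis
    by (intro card_subset_eq) auto
qed

text \<open>The lists \<open>Ps\<close> and \<open>Ls\<close> hold projective planes and lines, of
  vector-space dimensions 3 and 2, and their complements form the multispread. In the size condition
  2 is the covering number and 25 is 5^(5 - 3), as in \<open>multispread_perp\<close>.\<close>

lemma multispread_of_bases:
  fixes Ps Ls :: "vec5 list list"
  assumes sort: "sort5 (concat (map points5 (Ps @ Ls))) = sort5 (points5 unit5 @ points5 unit5)"
    and len: "list_all (\<lambda>bs. length bs = 3) Ps" "list_all (\<lambda>bs. length bs = 2) Ls"
    and size: "length Ps + length Ls = 2 + m * 25"
  shows "\<exists>S :: (gf5 ^ 5) set multiset.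
    (\<forall>U\<in>#S. vec.subspace U \<and> vec.dim U \<in> {2, 3}) \<and>
    size {# U \<in># S. vec.dim U = 2 #} = length Ps \<and>
    size {# U \<in># S. vec.dim U = 3 #} = length Ls \<and>
    (\<forall>H. hyperplane H \<longrightarrow> size {# U \<in># S. U \<subseteq> H #} = 2) \<and>
    multispread 3 (4 * length Ps) m S"
proof -
  define sp where "sp bs = vec.span (set (map vec_of bs))" for bs
  let ?cs = "[0, 1, 2, 3, 4 :: gf5]"
  define T where "T = mset (map sp (Ps @ Ls))"
  have "mset (concat (map points5 (Ps @ Ls))) = mset (points5 unit5 @ points5 unit5)"
    using arg_cong[OF sort, of mset] by (simp only: mset_sort5)
  then have "mset (map vec_of (concat (map points5 (Ps @ Ls)))) =
      mset (map vec_of (points5 unit5 @ points5 unit5))"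
    by (simp only: mset_map)
  moreover have "map vec_of (concat (map points5 (Ps @ Ls))) =
      concat (map (points ?cs) (map (map vec_of) (Ps @ Ls)))"
    by (simp only: map_concat map_map o_def map_vec_of_points5)
  moreover have "mset (map vec_of (points5 unit5 @ points5 unit5)) =
      repeat_mset 2 (mset (points ?cs (map vec_of unit5)))"
    by (simp only: map_append map_vec_of_points5 mset_append numeral_2_eq_2 repeat_mset_Suc repeat_mset_0 add_0_right)
  ultimately have cover: "mset (concat (map (points ?cs) (map (map vec_of) (Ps @ Ls)))) =
      repeat_mset 2 (mset (points ?cs (map vec_of unit5)))"
    by (simp only:)
  note pc = projective_cover[OF UNIV_gf5 distinct_gf5 span_unit5 zero_notin_points_unit5 cover]
  have dim: "vec.dim (sp bs) = length bs" if "bs \<in> set (Ps @ Ls)" for bs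
  proof -
    have "map vec_of bs \<in> set (map (map vec_of) (Ps @ Ls))"
      unfolding set_map using that by (rule imageI)
    from bspec[OF pc(1) this] show ?thesis
      unfolding sp_def by (simp only: length_map)
  qed
  have dim3: "vec.dim (sp bs) = 3" if "bs \<in> set Ps" for bs
    using dim[of bs] len(1) that by (simp add: list_all_iff)
  have dim2: "vec.dim (sp bs) = 2" if "bs \<in> set Ls" for bs
    using dim[of bs] len(2) that by (simp add: list_all_iff)
  have T_alt: "T = mset (map (\<lambda>bs. vec.span (set bs)) (map (map vec_of) (Ps @ Ls)))"
    by (simp add: T_def sp_def[abs_def] o_def)
  have T2: "size {#W \<in># T. y \<in> W#} = 2" if "y \<noteq> 0" for y
    unfolding T_alt by (rule pc(2)[OF that])
  have sub: "vec.subspace W \<and> vec.dim W \<in> {2, 3}" if W: "W \<in># T" for W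
  proof -
    obtain bs where bs: "bs \<in> set Ps \<or> bs \<in> set Ls" "W = sp bs"
      using W by (auto simp: T_def)
    moreover have "vec.subspace (sp bs)"
      unfolding sp_def by (rule vec.subspace_span)
    ultimately show ?thesis
      using dim2[of bs] dim3[of bs] by (elim disjE) simp_all
  qed
  have dim_perp': "vec.dim (perp W) = 5 - vec.dim W" if "W \<in># T" for W
    using dim_perp[of W] sub[OF that] by auto
  have count_dim: "size {#U \<in># image_mset perp T. vec.dim U = k#} =
      length (filter (\<lambda>W. vec.dim W = 5 - k) (map sp (Ps @ Ls)))" if "k \<in> {2, 3}" for k
  proof -
    have "filter_mset (\<lambda>W. vec.dim (perp W) = k) T = filter_mset (\<lambda>W. vec.dim W = 5 - k) T"
      using that sub by (intro filter_mset_cong) (auto simp: dim_perp')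
    then show ?thesis
      by (simp only: filter_mset_image_mset size_image_mset T_def mset_filter[symmetric] size_mset)
  qed
  have f: "filter (\<lambda>W. vec.dim W = 3) (map sp (Ps @ Ls)) = map sp Ps"
    "filter (\<lambda>W. vec.dim W = 2) (map sp (Ps @ Ls)) = map sp Ls"
    by (simp_all add: filter_map o_def dim2 dim3 cong: filter_cong)
  have "(\<Sum>W\<in>#T. CARD(gf5) ^ (3 - (CARD(5) - vec.dim W)) - 1) =
      (\<Sum>bs\<in>#mset Ps. CARD(gf5) ^ (3 - (CARD(5) - vec.dim (sp bs))) - 1)
      + (\<Sum>bs\<in>#mset Ls. CARD(gf5) ^ (3 - (CARD(5) - vec.dim (sp bs))) - 1)"
    by (simp add: T_def image_mset.compositionality o_def)
  \<comment> \<open>The complement of a plane has dimension 2 and contributes 5^(3 - 2) - 1 = 4,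
    that of a line has dimension 3 and contributes 5^0 - 1 = 0.\<close>
  also have "\<dots> = (\<Sum>bs\<in>#mset Ps. 4) + (\<Sum>bs\<in>#mset Ls. 0)"
    by (intro arg_cong2[where f = "(+)"] arg_cong[where f = sum_mset] image_mset_cong)
      (auto simp: dim2 dim3 CARD_finite_5)
  also have "\<dots> = 4 * length Ps"
    by simp
  finally have sum: "(\<Sum>W\<in>#T. CARD(gf5) ^ (3 - (CARD(5) - vec.dim W)) - 1) = 4 * length Ps" .
  have "multispread 3 (4 * length Ps) m (image_mset perp T)"
    unfolding sum[symmetric]
  proof (rule multispread_perp)
    show "\<forall>W\<in>#T. vec.subspace W \<and> CARD(5) \<le> 3 + vec.dim W"
    proof
      fix W assume "W \<in># T"
      from sub[OF this] show "vec.subspace W \<and> CARD(5) \<le> 3 + vec.dim W"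
        by auto
    qed
    show "size T = 2 + m * CARD(gf5) ^ (CARD(5) - 3)"
      using size by (simp add: T_def CARD_finite_5)
  qed (simp_all add: T2)
  moreover have "\<forall>H. hyperplane H \<longrightarrow> size {#U \<in># image_mset perp T. U \<subseteq> H#} = 2"
  proof (intro allI impI)
    fix H :: "(gf5 ^ 5) set" assume H: "hyperplane H"
    show "size {#U \<in># image_mset perp T. U \<subseteq> H#} = 2"
    proof (rule size_perp_subset_hyperplane[OF _ _ H])
      show "\<forall>W\<in>#T. vec.subspace W"
        by (simp add: sub)
    qed (rule T2)
  qed
  moreover have "\<forall>U\<in>#image_mset perp T. vec.subspace U \<and> vec.dim U \<in> {2, 3}"
  proof
    fix U assume "U \<in># image_mset perp T"
    then obtain W where W: "W \<in># T" "U = perp W"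
      by auto
    from sub[OF W(1)] dim_perp'[OF W(1)] show "vec.subspace U \<and> vec.dim U \<in> {2, 3}"
      by (auto simp: W(2) subspace_perp)
  qed
  moreover have "size {#U \<in># image_mset perp T. vec.dim U = 2#} = length Ps"
    using count_dim[of 2] f(1) by (simp del: map_append)
  moreover have "size {#U \<in># image_mset perp T. vec.dim U = 3#} = length Ls"
    using count_dim[of 3] f(2) by (simp del: map_append)
  ultimately show ?thesis
    by (intro exI[of _ "image_mset perp T"] conjI)
qed

section \<open>The three covers\<close>

text \<open>All bases of the covers are in echelon form with leading coefficients 1. Then each
  listed combination has first non-zero coordinate 1, the normalisation used by the standard basis,
  and a point gets the same representative from every subspace containing it.\<close>

definition planes_20 :: "vec5 list list" where
  "planes_20 = [
    [V D1 D0 D0 D3 D4, V D0 D1 D0 D4 D0, V D0 D0 D1 D1 D3],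
    [V D1 D0 D0 D2 D1, V D0 D1 D0 D1 D0, V D0 D0 D1 D1 D3],
    [V D1 D0 D0 D1 D4, V D0 D1 D0 D1 D3, V D0 D0 D1 D4 D0],
    [V D1 D0 D0 D3 D2, V D0 D1 D0 D1 D2, V D0 D0 D1 D3 D0],
    [V D1 D0 D0 D4 D2, V D0 D1 D0 D1 D4, V D0 D0 D1 D0 D1],
    [V D1 D0 D0 D0 D1, V D0 D1 D0 D1 D1, V D0 D0 D1 D2 D1],
    [V D1 D0 D0 D0 D4, V D0 D1 D0 D4 D4, V D0 D0 D1 D2 D1],
    [V D1 D0 D0 D1 D3, V D0 D1 D0 D4 D1, V D0 D0 D1 D0 D1],
    [V D1 D0 D0 D2 D3, V D0 D1 D0 D4 D3, V D0 D0 D1 D3 D0],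
    [V D1 D0 D0 D4 D1, V D0 D1 D0 D4 D2, V D0 D0 D1 D4 D0],
    [V D1 D0 D0 D1 D1, V D0 D1 D0 D1 D2, V D0 D0 D1 D3 D3],
    [V D1 D0 D0 D4 D4, V D0 D1 D0 D4 D3, V D0 D0 D1 D3 D3],
    [V D1 D0 D0 D0 D4, V D0 D1 D0 D1 D0, V D0 D0 D1 D1 D1],
    [V D1 D0 D0 D3 D3, V D0 D1 D0 D4 D1, V D0 D0 D1 D0 D4],
    [V D1 D0 D0 D2 D3, V D0 D1 D0 D4 D4, V D0 D0 D1 D2 D4],
    [V D1 D0 D0 D1 D4, V D0 D1 D0 D4 D2, V D0 D0 D1 D4 D3],
    [V D1 D0 D0 D4 D1, V D0 D1 D0 D1 D3, V D0 D0 D1 D4 D3],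
    [V D1 D0 D0 D3 D2, V D0 D1 D0 D1 D1, V D0 D0 D1 D2 D4],
    [V D1 D0 D0 D2 D2, V D0 D1 D0 D1 D4, V D0 D0 D1 D0 D4],
    [V D1 D0 D0 D0 D1, V D0 D1 D0 D4 D0, V D0 D0 D1 D1 D1]]"

definition lines_20 :: "vec5 list list" where
  "lines_20 = [
    [V D0 D1 D0 D0 D0, V D0 D0 D0 D0 D1], [V D0 D0 D0 D1 D0, V D0 D0 D0 D0 D1],
    [V D1 D0 D0 D0 D0, V D0 D1 D0 D0 D0], [V D1 D0 D0 D4 D3, V D0 D1 D0 D0 D2],
    [V D1 D0 D0 D1 D2, V D0 D1 D0 D0 D3], [V D1 D0 D0 D2 D0, V D0 D1 D0 D0 D1],
    [V D1 D0 D0 D3 D0, V D0 D1 D0 D0 D4], [V D0 D0 D1 D0 D2, V D0 D0 D0 D1 D0],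
    [V D0 D0 D1 D0 D3, V D0 D0 D0 D1 D1], [V D0 D0 D1 D0 D3, V D0 D0 D0 D1 D2],
    [V D0 D0 D1 D0 D2, V D0 D0 D0 D1 D3], [V D0 D0 D1 D0 D0, V D0 D0 D0 D1 D4],
    [V D1 D2 D0 D0 D0, V D0 D0 D1 D0 D0], [V D1 D4 D0 D0 D0, V D0 D0 D1 D1 D2],
    [V D1 D1 D0 D0 D0, V D0 D0 D1 D2 D0], [V D1 D3 D0 D0 D0, V D0 D0 D1 D3 D4],
    [V D1 D0 D0 D0 D0, V D0 D0 D1 D4 D4], [V D1 D0 D3 D2 D0, V D0 D1 D2 D0 D0],
    [V D1 D0 D1 D0 D0, V D0 D1 D2 D1 D3], [V D1 D0 D4 D1 D0, V D0 D1 D2 D2 D4],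
    [V D1 D0 D2 D0 D1, V D0 D1 D2 D3 D3], [V D1 D0 D0 D2 D4, V D0 D1 D2 D4 D0],
    [V D1 D0 D2 D3 D0, V D0 D1 D3 D0 D0], [V D1 D0 D0 D3 D1, V D0 D1 D3 D1 D0],
    [V D1 D0 D3 D0 D4, V D0 D1 D3 D2 D2], [V D1 D0 D1 D4 D0, V D0 D1 D3 D3 D1],
    [V D1 D0 D4 D0 D0, V D0 D1 D3 D4 D2], [V D1 D0 D0 D3 D4, V D0 D1 D1 D0 D4],
    [V D1 D0 D3 D1 D0, V D0 D1 D1 D1 D1], [V D1 D0 D1 D0 D4, V D0 D1 D1 D2 D4],
    [V D1 D0 D4 D0 D0, V D0 D1 D1 D3 D3], [V D1 D0 D2 D1 D2, V D0 D1 D1 D4 D3],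
    [V D1 D0 D0 D2 D1, V D0 D1 D4 D0 D1], [V D1 D0 D3 D4 D3, V D0 D1 D4 D1 D2],
    [V D1 D0 D1 D0 D0, V D0 D1 D4 D2 D2], [V D1 D0 D4 D0 D1, V D0 D1 D4 D3 D1],
    [V D1 D0 D2 D4 D0, V D0 D1 D4 D4 D4], [V D1 D0 D4 D3 D2, V D0 D1 D1 D0 D0],
    [V D1 D0 D2 D0 D4, V D0 D1 D1 D1 D2], [V D1 D0 D0 D3 D3, V D0 D1 D1 D2 D0],
    [V D1 D0 D3 D2 D3, V D0 D1 D1 D3 D4], [V D1 D0 D1 D2 D3, V D0 D1 D1 D4 D4],
    [V D1 D0 D1 D2 D3, V D0 D1 D4 D0 D0], [V D1 D0 D4 D3 D2, V D0 D1 D4 D1 D1],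
    [V D1 D0 D2 D3 D2, V D0 D1 D4 D2 D1], [V D1 D0 D0 D2 D2, V D0 D1 D4 D3 D0],
    [V D1 D0 D3 D0 D1, V D0 D1 D4 D4 D3], [V D1 D0 D1 D0 D1, V D0 D1 D0 D2 D0],
    [V D1 D0 D1 D1 D4, V D0 D1 D0 D2 D1], [V D1 D0 D1 D2 D4, V D0 D1 D0 D2 D2],
    [V D1 D0 D1 D3 D1, V D0 D1 D0 D2 D3], [V D1 D0 D1 D4 D0, V D0 D1 D0 D2 D4],
    [V D1 D0 D4 D0 D4, V D0 D1 D0 D3 D0], [V D1 D0 D4 D1 D0, V D0 D1 D0 D3 D1],
    [V D1 D0 D4 D2 D4, V D0 D1 D0 D3 D2], [V D1 D0 D4 D3 D1, V D0 D1 D0 D3 D3],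
    [V D1 D0 D4 D4 D1, V D0 D1 D0 D3 D4], [V D1 D0 D2 D1 D1, V D0 D1 D1 D0 D2],
    [V D1 D0 D0 D1 D3, V D0 D1 D1 D1 D4], [V D1 D0 D3 D2 D0, V D0 D1 D1 D2 D2],
    [V D1 D0 D1 D4 D1, V D0 D1 D1 D3 D1], [V D1 D0 D4 D2 D0, V D0 D1 D1 D4 D1],
    [V D1 D0 D3 D4 D4, V D0 D1 D4 D0 D3], [V D1 D0 D1 D3 D0, V D0 D1 D4 D1 D4],
    [V D1 D0 D4 D1 D4, V D0 D1 D4 D2 D4], [V D1 D0 D2 D3 D0, V D0 D1 D4 D3 D3],
    [V D1 D0 D0 D4 D2, V D0 D1 D4 D4 D1], [V D1 D0 D2 D3 D1, V D0 D1 D1 D0 D4],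
    [V D1 D0 D0 D3 D1, V D0 D1 D1 D1 D1], [V D1 D0 D3 D4 D1, V D0 D1 D1 D2 D4],
    [V D1 D0 D1 D1 D0, V D0 D1 D1 D3 D3], [V D1 D0 D4 D4 D2, V D0 D1 D1 D4 D3],
    [V D1 D0 D3 D2 D4, V D0 D1 D4 D0 D1], [V D1 D0 D1 D1 D3, V D0 D1 D4 D1 D2],
    [V D1 D0 D4 D4 D0, V D0 D1 D4 D2 D2], [V D1 D0 D2 D1 D4, V D0 D1 D4 D3 D1],
    [V D1 D0 D0 D2 D4, V D0 D1 D4 D4 D4], [V D1 D0 D4 D0 D2, V D0 D1 D2 D0 D2],
    [V D1 D0 D2 D1 D3, V D0 D1 D2 D1 D0], [V D1 D0 D0 D0 D3, V D0 D1 D2 D2 D1],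
    [V D1 D0 D3 D2 D3, V D0 D1 D2 D3 D0], [V D1 D0 D1 D2 D4, V D0 D1 D2 D4 D2],
    [V D1 D0 D1 D0 D3, V D0 D1 D3 D0 D3], [V D1 D0 D4 D3 D1, V D0 D1 D3 D1 D3],
    [V D1 D0 D2 D3 D2, V D0 D1 D3 D2 D0], [V D1 D0 D0 D0 D2, V D0 D1 D3 D3 D4],
    [V D1 D0 D3 D4 D2, V D0 D1 D3 D4 D0], [V D1 D0 D2 D0 D4, V D0 D1 D0 D2 D0],
    [V D1 D0 D2 D4 D1, V D0 D1 D0 D2 D1], [V D1 D0 D2 D3 D4, V D0 D1 D0 D2 D2],
    [V D1 D0 D2 D2 D3, V D0 D1 D0 D2 D3], [V D1 D0 D2 D1 D3, V D0 D1 D0 D2 D4],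
    [V D1 D0 D3 D0 D1, V D0 D1 D0 D3 D0], [V D1 D0 D3 D4 D2, V D0 D1 D0 D3 D1],
    [V D1 D0 D3 D3 D2, V D0 D1 D0 D3 D2], [V D1 D0 D3 D2 D1, V D0 D1 D0 D3 D3],
    [V D1 D0 D3 D1 D4, V D0 D1 D0 D3 D4], [V D1 D0 D4 D4 D2, V D0 D1 D1 D0 D0],
    [V D1 D0 D2 D1 D0, V D0 D1 D1 D1 D2], [V D1 D0 D0 D4 D0, V D0 D1 D1 D2 D0],
    [V D1 D0 D3 D3 D1, V D0 D1 D1 D3 D4], [V D1 D0 D1 D3 D2, V D0 D1 D1 D4 D4],
    [V D1 D0 D1 D1 D3, V D0 D1 D4 D0 D0], [V D1 D0 D4 D2 D3, V D0 D1 D4 D1 D1],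
    [V D1 D0 D2 D2 D4, V D0 D1 D4 D2 D1], [V D1 D0 D0 D1 D0, V D0 D1 D4 D3 D0],
    [V D1 D0 D3 D4 D0, V D0 D1 D4 D4 D3], [V D1 D0 D3 D0 D3, V D0 D1 D1 D0 D2],
    [V D1 D0 D1 D1 D1, V D0 D1 D1 D1 D4], [V D1 D0 D4 D3 D0, V D0 D1 D1 D2 D2],
    [V D1 D0 D2 D1 D4, V D0 D1 D1 D3 D1], [V D1 D0 D0 D0 D2, V D0 D1 D1 D4 D1],
    [V D1 D0 D2 D0 D2, V D0 D1 D4 D0 D3], [V D1 D0 D0 D0 D3, V D0 D1 D4 D1 D4],
    [V D1 D0 D3 D4 D1, V D0 D1 D4 D2 D4], [V D1 D0 D1 D2 D0, V D0 D1 D4 D3 D3],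
    [V D1 D0 D4 D4 D4, V D0 D1 D4 D4 D1], [V D1 D0 D2 D2 D4, V D0 D1 D2 D0 D0],
    [V D1 D0 D0 D2 D0, V D0 D1 D2 D1 D3], [V D1 D0 D3 D0 D2, V D0 D1 D2 D2 D4],
    [V D1 D0 D1 D1 D1, V D0 D1 D2 D3 D3], [V D1 D0 D4 D0 D3, V D0 D1 D2 D4 D0],
    [V D1 D0 D3 D3 D1, V D0 D1 D3 D0 D0], [V D1 D0 D1 D0 D2, V D0 D1 D3 D1 D0],
    [V D1 D0 D4 D4 D4, V D0 D1 D3 D2 D2], [V D1 D0 D2 D0 D3, V D0 D1 D3 D3 D1],
    [V D1 D0 D0 D3 D0, V D0 D1 D3 D4 D2], [V D1 D0 D1 D4 D3, V D0 D1 D2 D0 D2],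
    [V D1 D0 D4 D1 D4, V D0 D1 D2 D1 D0], [V D1 D0 D2 D1 D2, V D0 D1 D2 D2 D1],
    [V D1 D0 D0 D4 D3, V D0 D1 D2 D3 D0], [V D1 D0 D3 D0 D3, V D0 D1 D2 D4 D2],
    [V D1 D0 D4 D1 D2, V D0 D1 D3 D0 D3], [V D1 D0 D2 D0 D2, V D0 D1 D3 D1 D3],
    [V D1 D0 D0 D1 D2, V D0 D1 D3 D2 D0], [V D1 D0 D3 D4 D3, V D0 D1 D3 D3 D4],
    [V D1 D0 D1 D4 D1, V D0 D1 D3 D4 D0], [V D1 D0 D2 D4 D3, V D0 D1 D2 D0 D1],
    [V D1 D0 D0 D4 D4, V D0 D1 D2 D1 D4], [V D1 D0 D3 D2 D1, V D0 D1 D2 D2 D0],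
    [V D1 D0 D1 D3 D0, V D0 D1 D2 D3 D4], [V D1 D0 D4 D2 D2, V D0 D1 D2 D4 D1],
    [V D1 D0 D3 D1 D2, V D0 D1 D3 D0 D4], [V D1 D0 D1 D3 D3, V D0 D1 D3 D1 D4],
    [V D1 D0 D4 D2 D0, V D0 D1 D3 D2 D1], [V D1 D0 D2 D3 D4, V D0 D1 D3 D3 D0],
    [V D1 D0 D0 D1 D1, V D0 D1 D3 D4 D1], [V D1 D0 D0 D1 D0, V D0 D1 D2 D0 D1],
    [V D1 D0 D3 D0 D4, V D0 D1 D2 D1 D4], [V D1 D0 D1 D2 D1, V D0 D1 D2 D2 D0],
    [V D1 D0 D4 D2 D2, V D0 D1 D2 D3 D4], [V D1 D0 D2 D0 D3, V D0 D1 D2 D4 D1],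
    [V D1 D0 D0 D4 D0, V D0 D1 D3 D0 D4], [V D1 D0 D3 D0 D2, V D0 D1 D3 D1 D4],
    [V D1 D0 D1 D3 D3, V D0 D1 D3 D2 D1], [V D1 D0 D4 D3 D4, V D0 D1 D3 D3 D0],
    [V D1 D0 D2 D0 D1, V D0 D1 D3 D4 D1]]"

text \<open>Both lists have 20 * 31 + 157 * 6 = 2 * 781 entries.\<close>

lemma sort5_cover_20:
  "sort5 (concat (map points5 (planes_20 @ lines_20))) = sort5 (points5 unit5 @ points5 unit5)"
  by code_simp

lemma length_20:
  "length planes_20 = 20" "length lines_20 = 157"
  "list_all (\<lambda>bs. length bs = 3) planes_20" "list_all (\<lambda>bs. length bs = 2) lines_20"
  by (simp_all add: planes_20_def lines_20_def)

definition planes_14 :: "vec5 list list" where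
  "planes_14 = [
    [V D1 D0 D0 D4 D3, V D0 D1 D0 D1 D4, V D0 D0 D1 D4 D3],
    [V D1 D0 D0 D1 D3, V D0 D1 D0 D4 D4, V D0 D0 D1 D4 D2],
    [V D1 D0 D0 D2 D3, V D0 D1 D0 D0 D2, V D0 D0 D1 D0 D4],
    [V D1 D0 D0 D1 D2, V D0 D1 D0 D2 D3, V D0 D0 D1 D3 D4],
    [V D1 D0 D0 D4 D2, V D0 D1 D0 D3 D3, V D0 D0 D1 D3 D1],
    [V D1 D0 D0 D3 D3, V D0 D1 D0 D0 D2, V D0 D0 D1 D0 D1],
    [V D1 D0 D0 D1 D2, V D0 D1 D0 D0 D0, V D0 D0 D1 D1 D2],
    [V D1 D0 D0 D4 D2, V D0 D1 D0 D0 D0, V D0 D0 D1 D1 D3],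
    [V D1 D0 D0 D1 D4, V D0 D1 D0 D4 D1, V D0 D0 D1 D2 D2],
    [V D1 D0 D0 D4 D4, V D0 D1 D0 D1 D1, V D0 D0 D1 D2 D3],
    [V D1 D0 D2 D0 D3, V D0 D1 D4 D0 D1, V D0 D0 D0 D1 D2],
    [V D1 D0 D3 D0 D3, V D0 D1 D1 D0 D1, V D0 D0 D0 D1 D3],
    [V D1 D0 D1 D2 D0, V D0 D1 D1 D4 D0, V D0 D0 D0 D0 D1],
    [V D1 D0 D4 D3 D0, V D0 D1 D4 D1 D0, V D0 D0 D0 D0 D1]]"

definition lines_14 :: "vec5 list list" where
  "lines_14 = [
    [V D1 D0 D0 D2 D4, V D0 D1 D1 D2 D1], [V D1 D0 D2 D1 D4, V D0 D1 D2 D0 D0],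
    [V D1 D0 D3 D1 D2, V D0 D1 D2 D0 D4], [V D1 D0 D3 D4 D4, V D0 D1 D3 D0 D0],
    [V D1 D0 D2 D4 D2, V D0 D1 D3 D0 D4], [V D1 D0 D0 D3 D4, V D0 D1 D4 D3 D1],
    [V D1 D0 D1 D0 D1, V D0 D1 D1 D1 D0], [V D1 D0 D0 D4 D1, V D0 D1 D1 D3 D4],
    [V D1 D0 D3 D1 D3, V D0 D1 D1 D4 D1], [V D1 D0 D2 D4 D3, V D0 D1 D4 D1 D1],
    [V D1 D0 D0 D1 D1, V D0 D1 D4 D2 D4], [V D1 D0 D4 D0 D1, V D0 D1 D4 D4 D0],
    [V D1 D0 D4 D1 D1, V D0 D1 D1 D0 D3], [V D1 D0 D2 D0 D0, V D0 D1 D1 D2 D3],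
    [V D1 D0 D4 D4 D4, V D0 D1 D1 D2 D4], [V D1 D0 D1 D4 D1, V D0 D1 D4 D0 D3],
    [V D1 D0 D3 D0 D0, V D0 D1 D4 D3 D3], [V D1 D0 D1 D1 D4, V D0 D1 D4 D3 D4],
    [V D1 D0 D2 D4 D0, V D0 D1 D0 D1 D2], [V D1 D0 D3 D1 D0, V D0 D1 D0 D4 D2],
    [V D1 D0 D2 D4 D1, V D0 D1 D2 D0 D1], [V D1 D0 D2 D0 D4, V D0 D1 D2 D1 D2],
    [V D1 D0 D3 D1 D1, V D0 D1 D3 D0 D1], [V D1 D0 D3 D0 D4, V D0 D1 D3 D4 D2],
    [V D1 D0 D2 D0 D1, V D0 D1 D0 D1 D1], [V D1 D0 D3 D0 D1, V D0 D1 D0 D4 D1],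
    [V D1 D0 D4 D4 D0, V D0 D1 D1 D4 D2], [V D1 D0 D4 D2 D4, V D0 D1 D2 D4 D2],
    [V D1 D0 D1 D3 D4, V D0 D1 D3 D1 D2], [V D1 D0 D1 D1 D0, V D0 D1 D4 D1 D2],
    [V D1 D0 D2 D1 D1, V D0 D1 D1 D0 D0], [V D1 D0 D1 D1 D1, V D0 D1 D2 D1 D4],
    [V D1 D0 D0 D3 D3, V D0 D1 D2 D2 D1], [V D1 D0 D0 D2 D3, V D0 D1 D3 D3 D1],
    [V D1 D0 D4 D4 D1, V D0 D1 D3 D4 D4], [V D1 D0 D3 D4 D1, V D0 D1 D4 D0 D0],
    [V D1 D0 D0 D3 D2, V D0 D0 D1 D0 D1], [V D1 D0 D0 D2 D2, V D0 D0 D1 D0 D4],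
    [V D1 D3 D0 D3 D0, V D0 D0 D1 D3 D1], [V D1 D3 D0 D2 D0, V D0 D0 D1 D3 D4],
    [V D1 D4 D0 D2 D2, V D0 D0 D1 D4 D2], [V D1 D4 D0 D3 D2, V D0 D0 D1 D4 D3],
    [V D1 D0 D2 D3 D2, V D0 D1 D0 D2 D1], [V D1 D0 D3 D2 D2, V D0 D1 D0 D3 D1],
    [V D1 D0 D3 D2 D3, V D0 D1 D2 D1 D3], [V D1 D0 D0 D3 D0, V D0 D1 D2 D4 D1],
    [V D1 D0 D0 D2 D0, V D0 D1 D3 D1 D1], [V D1 D0 D2 D3 D3, V D0 D1 D3 D4 D3],
    [V D1 D3 D4 D0 D1, V D0 D0 D0 D1 D1], [V D1 D3 D1 D0 D1, V D0 D0 D0 D1 D4],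
    [V D1 D0 D0 D1 D4, V D0 D0 D1 D1 D1], [V D1 D0 D0 D4 D4, V D0 D0 D1 D1 D4],
    [V D1 D4 D0 D2 D0, V D0 D0 D1 D2 D1], [V D1 D4 D0 D3 D0, V D0 D0 D1 D2 D4],
    [V D1 D0 D4 D1 D0, V D0 D1 D1 D0 D4], [V D1 D0 D2 D0 D2, V D0 D1 D1 D2 D2],
    [V D1 D0 D4 D4 D3, V D0 D1 D1 D2 D4], [V D1 D0 D1 D4 D0, V D0 D1 D4 D0 D4],
    [V D1 D0 D3 D0 D2, V D0 D1 D4 D3 D2], [V D1 D0 D1 D1 D3, V D0 D1 D4 D3 D4],
    [V D1 D0 D4 D0 D4, V D0 D1 D0 D2 D3], [V D1 D0 D1 D0 D4, V D0 D1 D0 D3 D3],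
    [V D1 D0 D2 D1 D3, V D0 D1 D1 D2 D0], [V D1 D0 D3 D3 D3, V D0 D1 D2 D3 D2],
    [V D1 D0 D2 D2 D3, V D0 D1 D3 D2 D2], [V D1 D0 D3 D4 D3, V D0 D1 D4 D3 D0],
    [V D1 D0 D4 D1 D2, V D0 D1 D0 D2 D0], [V D1 D0 D1 D4 D2, V D0 D1 D0 D3 D0],
    [V D1 D0 D0 D2 D1, V D0 D1 D1 D1 D2], [V D1 D0 D1 D0 D2, V D0 D1 D2 D3 D3],
    [V D1 D0 D4 D0 D2, V D0 D1 D3 D2 D3], [V D1 D0 D0 D3 D1, V D0 D1 D4 D4 D2],
    [V D1 D1 D4 D0 D0, V D0 D0 D0 D1 D2], [V D1 D1 D1 D0 D0, V D0 D0 D0 D1 D3],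
    [V D1 D2 D0 D4 D4, V D0 D0 D1 D1 D2], [V D1 D2 D0 D1 D4, V D0 D0 D1 D1 D3],
    [V D0 D1 D0 D1 D3, V D0 D0 D1 D2 D2], [V D0 D1 D0 D4 D3, V D0 D0 D1 D2 D3],
    [V D1 D0 D0 D1 D0, V D0 D1 D1 D3 D3], [V D1 D0 D3 D3 D1, V D0 D1 D2 D0 D3],
    [V D1 D0 D4 D1 D4, V D0 D1 D2 D4 D4], [V D1 D0 D2 D2 D1, V D0 D1 D3 D0 D3],
    [V D1 D0 D1 D4 D4, V D0 D1 D3 D1 D4], [V D1 D0 D0 D4 D0, V D0 D1 D4 D2 D3],
    [V D1 D2 D0 D2 D3, V D0 D0 D1 D0 D2], [V D1 D2 D0 D3 D3, V D0 D0 D1 D0 D3],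
    [V D1 D1 D0 D3 D3, V D0 D0 D1 D3 D2], [V D1 D1 D0 D2 D3, V D0 D0 D1 D3 D3],
    [V D0 D1 D0 D4 D0, V D0 D0 D1 D4 D1], [V D0 D1 D0 D1 D0, V D0 D0 D1 D4 D4],
    [V D1 D0 D1 D1 D1, V D0 D1 D0 D2 D4], [V D1 D0 D4 D4 D1, V D0 D1 D0 D3 D4],
    [V D1 D0 D4 D0 D1, V D0 D1 D2 D3 D0], [V D1 D0 D0 D4 D3, V D0 D1 D2 D3 D1],
    [V D1 D0 D1 D0 D1, V D0 D1 D3 D2 D0], [V D1 D0 D0 D1 D3, V D0 D1 D3 D2 D1],
    [V D1 D0 D2 D2 D4, V D0 D1 D1 D2 D1], [V D1 D0 D2 D1 D4, V D0 D1 D1 D4 D0],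
    [V D1 D0 D3 D3 D2, V D0 D1 D2 D1 D4], [V D1 D0 D2 D2 D2, V D0 D1 D3 D4 D4],
    [V D1 D0 D3 D4 D4, V D0 D1 D4 D1 D0], [V D1 D0 D3 D3 D4, V D0 D1 D4 D3 D1],
    [V D1 D0 D1 D0 D4, V D0 D1 D2 D1 D1], [V D1 D0 D0 D2 D4, V D0 D1 D2 D2 D0],
    [V D1 D0 D1 D3 D2, V D0 D1 D2 D2 D4], [V D1 D0 D0 D3 D4, V D0 D1 D3 D3 D0],
    [V D1 D0 D4 D2 D2, V D0 D1 D3 D3 D4], [V D1 D0 D4 D0 D4, V D0 D1 D3 D4 D1],
    [V D1 D0 D1 D4 D0, V D0 D1 D2 D2 D0], [V D1 D0 D4 D1 D0, V D0 D1 D3 D3 D0],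
    [V D1 D0 D3 D2 D2, V D0 D1 D0 D2 D2], [V D1 D0 D3 D1 D3, V D0 D1 D0 D2 D4],
    [V D1 D0 D2 D3 D2, V D0 D1 D0 D3 D2], [V D1 D0 D2 D4 D3, V D0 D1 D0 D3 D4],
    [V D1 D0 D1 D3 D0, V D0 D1 D1 D4 D4], [V D1 D0 D4 D2 D0, V D0 D1 D4 D1 D4],
    [V D1 D0 D1 D0 D2, V D0 D1 D2 D1 D0], [V D1 D0 D0 D2 D1, V D0 D1 D2 D2 D2],
    [V D1 D0 D1 D3 D2, V D0 D1 D2 D2 D3], [V D1 D0 D0 D3 D1, V D0 D1 D3 D3 D2],
    [V D1 D0 D4 D2 D2, V D0 D1 D3 D3 D3], [V D1 D0 D4 D0 D2, V D0 D1 D3 D4 D0],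
    [V D1 D0 D0 D4 D1, V D0 D0 D1 D0 D2], [V D1 D0 D0 D1 D1, V D0 D0 D1 D0 D3],
    [V D1 D3 D0 D4 D4, V D0 D0 D1 D3 D2], [V D1 D3 D0 D1 D4, V D0 D0 D1 D3 D3],
    [V D1 D4 D0 D4 D0, V D0 D0 D1 D4 D1], [V D1 D4 D0 D1 D0, V D0 D0 D1 D4 D4],
    [V D1 D0 D4 D2 D0, V D0 D1 D1 D2 D0], [V D1 D0 D1 D3 D0, V D0 D1 D4 D3 D0],
    [V D1 D0 D2 D0 D0, V D0 D1 D0 D2 D0], [V D1 D0 D3 D0 D0, V D0 D1 D0 D3 D0],
    [V D1 D0 D4 D4 D2, V D0 D1 D1 D3 D2], [V D1 D0 D4 D2 D3, V D0 D1 D2 D3 D4],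
    [V D1 D0 D4 D4 D0, V D0 D1 D2 D4 D4], [V D1 D0 D1 D1 D0, V D0 D1 D3 D1 D4],
    [V D1 D0 D1 D3 D3, V D0 D1 D3 D2 D4], [V D1 D0 D1 D1 D2, V D0 D1 D4 D2 D2],
    [V D1 D0 D0 D4 D0, V D0 D1 D2 D1 D0], [V D1 D0 D0 D1 D0, V D0 D1 D3 D4 D0],
    [V D1 D0 D0 D2 D2, V D0 D1 D0 D1 D4], [V D1 D0 D0 D3 D2, V D0 D1 D0 D4 D4],
    [V D1 D0 D0 D0 D4, V D0 D1 D1 D1 D0], [V D1 D0 D2 D4 D4, V D0 D1 D2 D4 D1],
    [V D1 D0 D3 D1 D4, V D0 D1 D3 D1 D1], [V D1 D0 D0 D0 D4, V D0 D1 D4 D4 D0],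
    [V D1 D0 D1 D4 D2, V D0 D1 D0 D0 D1], [V D1 D0 D4 D1 D2, V D0 D1 D0 D0 D1],
    [V D1 D0 D1 D0 D3, V D0 D1 D2 D0 D3], [V D1 D0 D3 D4 D0, V D0 D1 D2 D1 D1],
    [V D1 D0 D4 D0 D3, V D0 D1 D3 D0 D3], [V D1 D0 D2 D1 D0, V D0 D1 D3 D4 D1],
    [V D1 D0 D2 D0 D2, V D0 D1 D1 D0 D0], [V D1 D0 D2 D1 D1, V D0 D1 D2 D1 D2],
    [V D1 D0 D0 D0 D2, V D0 D1 D2 D3 D3], [V D1 D0 D0 D0 D2, V D0 D1 D3 D2 D3],
    [V D1 D0 D3 D4 D1, V D0 D1 D3 D4 D2], [V D1 D0 D3 D0 D2, V D0 D1 D4 D0 D0],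
    [V D1 D0 D0 D2 D0, V D0 D1 D0 D1 D2], [V D1 D0 D0 D3 D0, V D0 D1 D0 D4 D2],
    [V D1 D0 D0 D0 D1, V D0 D1 D1 D1 D1], [V D1 D0 D2 D4 D4, V D0 D1 D2 D4 D2],
    [V D1 D0 D3 D1 D4, V D0 D1 D3 D1 D2], [V D1 D0 D0 D0 D1, V D0 D1 D4 D4 D1],
    [V D1 D0 D0 D0 D0, V D0 D1 D1 D3 D2], [V D1 D0 D2 D0 D1, V D0 D1 D2 D0 D1],
    [V D1 D0 D4 D1 D4, V D0 D1 D2 D3 D2], [V D1 D0 D3 D0 D1, V D0 D1 D3 D0 D1],
    [V D1 D0 D1 D4 D4, V D0 D1 D3 D2 D2], [V D1 D0 D0 D0 D0, V D0 D1 D4 D2 D2],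
    [V D0 D1 D0 D0 D4, V D0 D0 D0 D1 D1], [V D0 D1 D0 D0 D4, V D0 D0 D0 D1 D4],
    [V D1 D1 D0 D0 D4, V D0 D0 D1 D1 D1], [V D1 D1 D0 D0 D4, V D0 D0 D1 D1 D4],
    [V D1 D2 D0 D0 D1, V D0 D0 D1 D2 D1], [V D1 D2 D0 D0 D1, V D0 D0 D1 D2 D4],
    [V D1 D3 D0 D0 D3, V D0 D0 D1 D0 D0], [V D1 D4 D0 D0 D1, V D0 D0 D1 D3 D0],
    [V D1 D0 D0 D0 D3, V D0 D0 D1 D4 D0], [V D1 D3 D0 D0 D3, V D0 D0 D0 D1 D0],
    [V D1 D0 D0 D0 D3, V D0 D0 D1 D1 D0], [V D1 D4 D0 D0 D1, V D0 D0 D1 D2 D0],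
    [V D1 D1 D0 D0 D3, V D0 D0 D1 D0 D0], [V D0 D1 D0 D0 D3, V D0 D0 D1 D3 D0],
    [V D1 D2 D0 D0 D2, V D0 D0 D1 D4 D0], [V D1 D1 D0 D0 D3, V D0 D0 D0 D1 D0],
    [V D1 D2 D0 D0 D2, V D0 D0 D1 D1 D0], [V D0 D1 D0 D0 D3, V D0 D0 D1 D2 D0]]"

text \<open>The number of points is again 14 * 31 + 188 * 6 = 1562.\<close>

lemma sort5_cover_14:
  "sort5 (concat (map points5 (planes_14 @ lines_14))) = sort5 (points5 unit5 @ points5 unit5)"
  by code_simp

lemma length_14:
  "length planes_14 = 14" "length lines_14 = 188"
  "list_all (\<lambda>bs. length bs = 3) planes_14" "list_all (\<lambda>bs. length bs = 2) lines_14"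
  by (simp_all add: planes_14_def lines_14_def)

definition planes_8 :: "vec5 list list" where
  "planes_8 = [
    [V D1 D0 D2 D3 D0, V D0 D1 D4 D4 D0, V D0 D0 D0 D0 D1],
    [V D1 D0 D0 D4 D3, V D0 D1 D0 D0 D2, V D0 D0 D1 D4 D3],
    [V D1 D0 D0 D2 D3, V D0 D1 D0 D3 D4, V D0 D0 D1 D3 D4],
    [V D1 D0 D0 D1 D1, V D0 D1 D0 D2 D1, V D0 D0 D1 D0 D4],
    [V D1 D0 D0 D1 D2, V D0 D1 D0 D4 D0, V D0 D0 D1 D4 D2],
    [V D1 D0 D0 D4 D4, V D0 D1 D0 D3 D2, V D0 D0 D1 D3 D1],
    [V D1 D0 D0 D3 D2, V D0 D1 D0 D0 D2, V D0 D0 D1 D0 D1],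
    [V D0 D0 D1 D0 D0, V D0 D0 D0 D1 D0, V D0 D0 D0 D0 D1]]"

definition lines_8 :: "vec5 list list" where
  "lines_8 = [
    [V D1 D0 D4 D2 D4, V D0 D1 D0 D4 D4], [V D1 D0 D1 D1 D4, V D0 D1 D1 D2 D4],
    [V D1 D0 D4 D0 D1, V D0 D1 D1 D4 D3], [V D1 D0 D3 D3 D0, V D0 D1 D3 D0 D3],
    [V D1 D0 D1 D2 D1, V D0 D1 D3 D2 D3], [V D1 D0 D3 D1 D0, V D0 D1 D4 D0 D3],
    [V D1 D0 D1 D2 D4, V D0 D1 D0 D2 D4], [V D1 D0 D3 D0 D0, V D0 D1 D0 D4 D3],
    [V D1 D0 D1 D0 D1, V D0 D1 D1 D2 D3], [V D1 D0 D3 D4 D0, V D0 D1 D2 D0 D3],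
    [V D1 D0 D1 D3 D4, V D0 D1 D3 D1 D4], [V D1 D0 D1 D1 D1, V D0 D1 D4 D1 D3],
    [V D1 D0 D3 D3 D3, V D0 D1 D0 D2 D2], [V D1 D0 D1 D2 D2, V D0 D1 D1 D3 D3],
    [V D1 D0 D3 D1 D2, V D0 D1 D2 D1 D0], [V D1 D0 D3 D4 D1, V D0 D1 D3 D1 D2],
    [V D1 D0 D1 D1 D3, V D0 D1 D3 D4 D0], [V D1 D0 D3 D0 D4, V D0 D1 D4 D2 D3],
    [V D1 D0 D4 D4 D4, V D0 D1 D0 D1 D0], [V D1 D0 D4 D3 D1, V D0 D1 D1 D3 D4],
    [V D1 D0 D4 D0 D4, V D0 D1 D2 D1 D1], [V D1 D0 D3 D1 D3, V D0 D1 D3 D4 D1],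
    [V D1 D0 D3 D3 D2, V D0 D1 D4 D2 D4], [V D1 D0 D4 D2 D1, V D0 D1 D4 D3 D0],
    [V D1 D0 D3 D0 D3, V D0 D1 D0 D2 D0], [V D1 D0 D0 D4 D4, V D0 D1 D1 D0 D3],
    [V D1 D0 D0 D2 D3, V D0 D1 D2 D0 D2], [V D1 D0 D3 D4 D2, V D0 D1 D2 D3 D3],
    [V D1 D0 D0 D3 D2, V D0 D1 D3 D1 D0], [V D1 D0 D0 D1 D1, V D0 D1 D4 D1 D2],
    [V D1 D0 D1 D3 D0, V D0 D1 D0 D1 D4], [V D1 D0 D2 D4 D2, V D0 D1 D1 D0 D2],
    [V D1 D0 D2 D2 D3, V D0 D1 D2 D0 D4], [V D1 D0 D4 D3 D2, V D0 D1 D2 D3 D2],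
    [V D1 D0 D1 D0 D0, V D0 D1 D4 D1 D4], [V D1 D0 D4 D4 D3, V D0 D1 D4 D3 D4],
    [V D1 D0 D4 D3 D4, V D0 D1 D0 D2 D3], [V D1 D0 D1 D2 D3, V D0 D1 D1 D0 D0],
    [V D1 D0 D4 D4 D1, V D0 D1 D1 D3 D2], [V D1 D0 D4 D2 D2, V D0 D1 D2 D3 D0],
    [V D1 D0 D1 D1 D2, V D0 D1 D3 D1 D3], [V D1 D0 D4 D0 D3, V D0 D1 D4 D2 D2],
    [V D1 D0 D3 D1 D4, V D0 D1 D0 D4 D0], [V D1 D0 D2 D2 D1, V D0 D1 D1 D2 D0],
    [V D1 D0 D2 D4 D4, V D0 D1 D2 D0 D1], [V D1 D0 D3 D3 D1, V D0 D1 D2 D1 D4],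
    [V D1 D0 D3 D0 D2, V D0 D1 D3 D4 D4], [V D1 D0 D3 D4 D3, V D0 D1 D4 D1 D1],
    [V D1 D0 D3 D4 D4, V D0 D1 D0 D1 D3], [V D1 D0 D1 D3 D3, V D0 D1 D0 D3 D0],
    [V D1 D0 D3 D0 D1, V D0 D1 D2 D1 D2], [V D1 D0 D0 D1 D2, V D0 D1 D2 D4 D0],
    [V D1 D0 D0 D4 D3, V D0 D1 D3 D4 D2], [V D1 D0 D1 D0 D2, V D0 D1 D4 D3 D3],
    [V D1 D0 D4 D2 D0, V D0 D1 D0 D2 D1], [V D1 D0 D2 D1 D2, V D0 D1 D0 D4 D1],
    [V D1 D0 D4 D0 D0, V D0 D1 D1 D2 D1], [V D1 D0 D0 D1 D3, V D0 D1 D2 D1 D3],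
    [V D1 D0 D0 D4 D2, V D0 D1 D3 D1 D1], [V D1 D0 D2 D0 D3, V D0 D1 D3 D4 D3],
    [V D1 D0 D2 D0 D1, V D0 D1 D0 D3 D1], [V D1 D0 D0 D4 D0, V D0 D1 D1 D4 D2],
    [V D1 D0 D0 D2 D1, V D0 D1 D2 D4 D1], [V D1 D0 D0 D3 D4, V D0 D1 D3 D0 D2],
    [V D1 D0 D2 D1 D4, V D0 D1 D3 D2 D2], [V D1 D0 D0 D1 D0, V D0 D1 D4 D0 D2],
    [V D1 D0 D2 D0 D0, V D0 D1 D0 D1 D1], [V D1 D0 D4 D3 D3, V D0 D1 D0 D3 D3],
    [V D1 D0 D4 D4 D2, V D0 D1 D1 D4 D1], [V D1 D0 D4 D2 D3, V D0 D1 D2 D4 D3],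
    [V D1 D0 D2 D1 D0, V D0 D1 D3 D0 D1], [V D1 D0 D4 D0 D2, V D0 D1 D4 D3 D1],
    [V D1 D0 D3 D1 D1, V D0 D1 D0 D3 D4], [V D1 D0 D0 D1 D4, V D0 D1 D1 D3 D1],
    [V D1 D0 D3 D3 D4, V D0 D1 D2 D0 D0], [V D1 D0 D4 D1 D2, V D0 D1 D2 D4 D4],
    [V D1 D0 D0 D4 D1, V D0 D1 D4 D1 D0], [V D1 D0 D4 D1 D3, V D0 D1 D4 D2 D1],
    [V D1 D0 D4 D1 D4, V D0 D1 D0 D1 D2], [V D1 D0 D1 D2 D0, V D0 D1 D0 D4 D2],
    [V D1 D0 D4 D1 D1, V D0 D1 D1 D0 D1], [V D1 D0 D2 D0 D4, V D0 D1 D1 D2 D2],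
    [V D1 D0 D2 D1 D1, V D0 D1 D2 D3 D1], [V D1 D0 D1 D1 D0, V D0 D1 D4 D3 D2],
    [V D1 D0 D2 D2 D0, V D0 D1 D0 D1 D4], [V D1 D0 D1 D4 D2, V D0 D1 D0 D2 D2],
    [V D1 D0 D3 D2 D2, V D0 D1 D3 D1 D2], [V D1 D0 D2 D4 D0, V D0 D1 D3 D2 D4],
    [V D1 D0 D3 D2 D3, V D0 D1 D4 D0 D4], [V D1 D0 D1 D4 D3, V D0 D1 D4 D3 D4],
    [V D1 D0 D2 D3 D3, V D0 D1 D0 D2 D0], [V D1 D0 D3 D2 D1, V D0 D1 D0 D3 D2],
    [V D1 D0 D3 D2 D4, V D0 D1 D2 D1 D3], [V D1 D0 D0 D3 D3, V D0 D1 D2 D4 D2],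
    [V D1 D0 D0 D2 D2, V D0 D1 D3 D1 D0], [V D1 D0 D2 D3 D2, V D0 D1 D3 D4 D3],
    [V D1 D4 D0 D0 D3, V D0 D0 D1 D0 D2], [V D1 D0 D0 D0 D1, V D0 D0 D1 D0 D3],
    [V D1 D0 D0 D0 D4, V D0 D0 D1 D3 D2], [V D1 D3 D0 D0 D1, V D0 D0 D1 D3 D3],
    [V D1 D4 D0 D0 D2, V D0 D0 D1 D4 D1], [V D1 D3 D0 D0 D4, V D0 D0 D1 D4 D4],
    [V D1 D0 D0 D0 D3, V D0 D1 D1 D3 D1], [V D1 D0 D1 D4 D4, V D0 D1 D1 D4 D0],
    [V D1 D0 D3 D0 D1, V D0 D1 D3 D0 D0], [V D1 D0 D1 D4 D1, V D0 D1 D3 D2 D4],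
    [V D1 D0 D0 D0 D2, V D0 D1 D4 D0 D4], [V D1 D0 D3 D4 D4, V D0 D1 D4 D2 D1],
    [V D1 D0 D4 D4 D0, V D0 D1 D0 D1 D3], [V D1 D0 D4 D3 D0, V D0 D1 D1 D3 D3],
    [V D1 D0 D4 D0 D4, V D0 D1 D2 D1 D4], [V D1 D0 D3 D1 D4, V D0 D1 D3 D4 D4],
    [V D1 D0 D3 D3 D1, V D0 D1 D4 D2 D3], [V D1 D0 D4 D2 D1, V D0 D1 D4 D3 D3],
    [V D1 D0 D2 D2 D2, V D0 D1 D1 D0 D2], [V D1 D0 D2 D2 D0, V D0 D1 D1 D0 D4],
    [V D1 D0 D2 D2 D3, V D0 D1 D1 D0 D4], [V D1 D0 D2 D4 D2, V D0 D1 D2 D3 D2],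
    [V D1 D0 D2 D4 D0, V D0 D1 D2 D3 D4], [V D1 D0 D2 D4 D3, V D0 D1 D2 D3 D4],
    [V D1 D0 D2 D4 D1, V D0 D1 D0 D1 D0], [V D1 D0 D2 D1 D2, V D0 D1 D1 D4 D4],
    [V D1 D0 D2 D0 D3, V D0 D1 D2 D1 D1], [V D1 D0 D3 D1 D1, V D0 D1 D3 D0 D4],
    [V D1 D0 D2 D2 D4, V D0 D1 D3 D4 D1], [V D1 D0 D3 D3 D4, V D0 D1 D4 D3 D0],
    [V D1 D0 D1 D1 D2, V D0 D1 D0 D4 D3], [V D1 D0 D1 D3 D4, V D0 D1 D1 D2 D3],
    [V D1 D0 D2 D2 D2, V D0 D1 D1 D3 D0], [V D1 D0 D2 D4 D3, V D0 D1 D2 D1 D2],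
    [V D1 D0 D1 D0 D1, V D0 D1 D3 D4 D2], [V D1 D0 D1 D2 D3, V D0 D1 D4 D2 D0],
    [V D1 D0 D0 D0 D3, V D0 D1 D1 D0 D1], [V D1 D0 D2 D1 D1, V D0 D1 D1 D3 D4],
    [V D1 D0 D2 D0 D4, V D0 D1 D2 D0 D0], [V D1 D0 D4 D1 D4, V D0 D1 D2 D3 D1],
    [V D1 D0 D4 D1 D1, V D0 D1 D4 D1 D0], [V D1 D0 D0 D0 D2, V D0 D1 D4 D2 D4],
    [V D1 D0 D1 D3 D2, V D0 D1 D1 D3 D0], [V D1 D0 D0 D0 D1, V D0 D1 D1 D4 D2],
    [V D1 D0 D4 D0 D2, V D0 D1 D2 D0 D3], [V D1 D0 D1 D0 D3, V D0 D1 D3 D0 D2],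
    [V D1 D0 D0 D0 D4, V D0 D1 D4 D1 D3], [V D1 D0 D4 D2 D3, V D0 D1 D4 D2 D0],
    [V D1 D0 D3 D2 D2, V D0 D1 D0 D2 D4], [V D1 D0 D2 D4 D4, V D0 D1 D0 D3 D0],
    [V D1 D0 D3 D2 D3, V D0 D1 D2 D0 D1], [V D1 D0 D4 D0 D1, V D0 D1 D2 D4 D0],
    [V D1 D0 D2 D2 D1, V D0 D1 D3 D1 D4], [V D1 D0 D4 D2 D4, V D0 D1 D4 D1 D1],
    [V D1 D0 D0 D3 D3, V D0 D1 D2 D1 D0], [V D1 D0 D4 D3 D3, V D0 D1 D3 D2 D2],
    [V D1 D0 D0 D2 D2, V D0 D1 D3 D3 D3], [V D1 D0 D3 D0 D4, V D0 D1 D3 D3 D3],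
    [V D1 D0 D4 D4 D2, V D0 D1 D3 D4 D0], [V D1 D0 D3 D4 D1, V D0 D1 D4 D0 D2],
    [V D1 D0 D3 D2 D1, V D0 D1 D0 D4 D4], [V D1 D0 D3 D4 D2, V D0 D1 D1 D2 D4],
    [V D1 D0 D3 D0 D3, V D0 D1 D1 D4 D1], [V D1 D0 D0 D4 D1, V D0 D1 D2 D2 D0],
    [V D1 D0 D3 D2 D4, V D0 D1 D2 D2 D0], [V D1 D0 D0 D1 D4, V D0 D1 D3 D0 D1],
    [V D1 D0 D1 D1 D1, V D0 D1 D0 D0 D1], [V D1 D0 D4 D4 D1, V D0 D1 D0 D0 D1],
    [V D1 D0 D0 D3 D0, V D0 D1 D0 D1 D2], [V D1 D0 D0 D2 D0, V D0 D1 D0 D4 D2],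
    [V D1 D0 D4 D3 D4, V D0 D1 D1 D2 D2], [V D1 D0 D1 D2 D4, V D0 D1 D4 D3 D2],
    [V D1 D0 D2 D1 D0, V D0 D1 D0 D3 D1], [V D1 D0 D2 D1 D3, V D0 D1 D0 D3 D3],
    [V D1 D0 D1 D4 D2, V D0 D1 D2 D4 D1], [V D1 D0 D1 D4 D3, V D0 D1 D2 D4 D3],
    [V D1 D0 D2 D0 D0, V D0 D1 D3 D3 D1], [V D1 D0 D2 D0 D2, V D0 D1 D3 D3 D1],
    [V D1 D0 D1 D3 D2, V D0 D1 D1 D1 D2], [V D1 D0 D3 D0 D2, V D0 D1 D1 D1 D2],
    [V D1 D0 D3 D4 D3, V D0 D1 D1 D4 D4], [V D1 D0 D4 D4 D0, V D0 D1 D3 D0 D4],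
    [V D1 D0 D1 D0 D3, V D0 D1 D3 D3 D4], [V D1 D0 D4 D3 D0, V D0 D1 D3 D3 D4],
    [V D1 D0 D1 D1 D3, V D0 D1 D0 D0 D3], [V D1 D0 D4 D4 D3, V D0 D1 D0 D0 D3],
    [V D1 D0 D0 D3 D0, V D0 D1 D0 D1 D1], [V D1 D0 D0 D2 D0, V D0 D1 D0 D4 D1],
    [V D1 D0 D4 D3 D2, V D0 D1 D1 D2 D1], [V D1 D0 D1 D2 D2, V D0 D1 D4 D3 D1],
    [V D0 D0 D1 D0 D0, V D0 D0 D0 D1 D0], [V D1 D2 D0 D0 D0, V D0 D0 D0 D1 D4],
    [V D0 D1 D0 D0 D0, V D0 D0 D1 D1 D4], [V D1 D1 D0 D0 D0, V D0 D0 D1 D2 D1],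
    [V D1 D0 D0 D0 D0, V D0 D0 D0 D1 D3], [V D1 D4 D0 D0 D0, V D0 D0 D1 D1 D3],
    [V D1 D3 D0 D0 D0, V D0 D0 D1 D2 D2], [V D1 D2 D0 D0 D1, V D0 D0 D0 D1 D2],
    [V D0 D1 D0 D0 D4, V D0 D0 D1 D1 D2], [V D1 D1 D0 D0 D4, V D0 D0 D1 D2 D3],
    [V D1 D2 D0 D0 D1, V D0 D0 D0 D1 D1], [V D0 D1 D0 D0 D4, V D0 D0 D1 D1 D1],
    [V D1 D1 D0 D0 D4, V D0 D0 D1 D2 D4], [V D1 D0 D3 D2 D0, V D0 D1 D1 D1 D0],
    [V D1 D0 D1 D4 D1, V D0 D1 D2 D2 D1], [V D1 D0 D1 D4 D0, V D0 D1 D2 D2 D2],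
    [V D1 D0 D1 D4 D4, V D0 D1 D2 D2 D2], [V D1 D0 D0 D0 D0, V D0 D1 D0 D2 D3],
    [V D1 D0 D1 D1 D4, V D0 D1 D1 D1 D4], [V D1 D0 D1 D2 D1, V D0 D1 D3 D1 D3],
    [V D1 D0 D3 D2 D0, V D0 D1 D1 D0 D0], [V D1 D0 D0 D1 D0, V D0 D1 D2 D3 D0],
    [V D1 D0 D0 D4 D0, V D0 D1 D3 D3 D0], [V D1 D0 D1 D3 D0, V D0 D1 D0 D0 D0],
    [V D1 D0 D4 D1 D0, V D0 D1 D3 D2 D0], [V D1 D0 D1 D0 D0, V D0 D1 D4 D0 D0],
    [V D1 D0 D0 D3 D1, V D0 D1 D1 D1 D1], [V D1 D0 D1 D4 D0, V D0 D1 D2 D0 D2],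
    [V D1 D0 D0 D2 D4, V D0 D1 D4 D1 D2], [V D1 D0 D2 D3 D0, V D0 D1 D4 D4 D0],
    [V D1 D0 D0 D3 D1, V D0 D1 D1 D4 D3], [V D1 D0 D4 D1 D0, V D0 D1 D3 D0 D3],
    [V D1 D0 D0 D2 D4, V D0 D1 D4 D4 D4]]"

text \<open>Here the balance is 8 * 31 + 219 * 6 = 1562.\<close>

lemma sort5_cover_8:
  "sort5 (concat (map points5 (planes_8 @ lines_8))) = sort5 (points5 unit5 @ points5 unit5)"
  by code_simp

lemma length_8:
  "length planes_8 = 8" "length lines_8 = 219"
  "list_all (\<lambda>bs. length bs = 3) planes_8" "list_all (\<lambda>bs. length bs = 2) lines_8"
  by (simp_all add: planes_8_def lines_8_def)

theorem mainTheorem8: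
  shows "(\<exists>S :: (gf5 ^ 5) set multiset.
        (\<forall>U\<in>#S. vec.subspace U \<and> vec.dim U \<in> {2, 3}) \<and>
        size {# U \<in># S. vec.dim U = 2 #} = 20 \<and>
        size {# U \<in># S. vec.dim U = 3 #} = 157 \<and>
        (\<forall>H. hyperplane H \<longrightarrow> size {# U \<in># S. U \<subseteq> H #} = 2) \<and>
        multispread 3 80 7 S) \<and>
    (\<exists>S :: (gf5 ^ 5) set multiset.
        (\<forall>U\<in>#S. vec.subspace U \<and> vec.dim U \<in> {2, 3}) \<and>
        size {# U \<in># S. vec.dim U = 2 #} = 14 \<and>
        size {# U \<in># S. vec.dim U = 3 #} = 188 \<and>
        (\<forall>H. hyperplane H \<longrightarrow> size {# U \<in># S. U \<subseteq> H #} = 2) \<and>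
        multispread 3 56 8 S) \<and>
    (\<exists>S :: (gf5 ^ 5) set multiset.
        (\<forall>U\<in>#S. vec.subspace U \<and> vec.dim U \<in> {2, 3}) \<and>
        size {# U \<in># S. vec.dim U = 2 #} = 8 \<and>
        size {# U \<in># S. vec.dim U = 3 #} = 219 \<and>
        (\<forall>H. hyperplane H \<longrightarrow> size {# U \<in># S. U \<subseteq> H #} = 2) \<and>
        multispread 3 32 9 S)"
proof (intro conjI)
  show "\<exists>S :: (gf5 ^ 5) set multiset.
        (\<forall>U\<in>#S. vec.subspace U \<and> vec.dim U \<in> {2, 3}) \<and>
        size {# U \<in># S. vec.dim U = 2 #} = 20 \<and>
        size {# U \<in># S. vec.dim U = 3 #} = 157 \<and>
        (\<forall>H. hyperplane H \<longrightarrow> size {# U \<in># S. U \<subseteq> H #} = 2) \<and>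
        multispread 3 80 7 S"
    \<comment> \<open>The parameters are 80 = 4 * 20 and 7 with 20 + 157 = 2 + 7 * 25. The other two
      cases use 14 + 188 = 2 + 8 * 25 and 8 + 219 = 2 + 9 * 25.\<close>
    using multispread_of_bases[OF sort5_cover_20 length_20(3,4), of 7] unfolding length_20(1,2) by simp
  show "\<exists>S :: (gf5 ^ 5) set multiset.
        (\<forall>U\<in>#S. vec.subspace U \<and> vec.dim U \<in> {2, 3}) \<and>
        size {# U \<in># S. vec.dim U = 2 #} = 14 \<and>
        size {# U \<in># S. vec.dim U = 3 #} = 188 \<and>
        (\<forall>H. hyperplane H \<longrightarrow> size {# U \<in># S. U \<subseteq> H #} = 2) \<and>
        multispread 3 56 8 S"
    using multispread_of_bases[OF sort5_cover_14 length_14(3,4), of 8] unfolding length_14(1,2) by simp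
  show "\<exists>S :: (gf5 ^ 5) set multiset.
        (\<forall>U\<in>#S. vec.subspace U \<and> vec.dim U \<in> {2, 3}) \<and>
        size {# U \<in># S. vec.dim U = 2 #} = 8 \<and>
        size {# U \<in># S. vec.dim U = 3 #} = 219 \<and>
        (\<forall>H. hyperplane H \<longrightarrow> size {# U \<in># S. U \<subseteq> H #} = 2) \<and>
        multispread 3 32 9 S"
    using multispread_of_bases[OF sort5_cover_8 length_8(3,4), of 9] unfolding length_8(1,2) by simp
qed

end
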